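(* Let $M,a$ be real constants and $k\in\tfrac12\mathbb{Z}$. On the region $\mathcal{U}=\{(t,r,q,\phi): \Delta(r)>0,\ -1<q<1\}$, with $q=\cos\theta$, $\theta\in(0,\pi)$, let $g=\lambda_+^2 g_{Kerr}$ be the complex metric conformal to the Kerr metric, let $\nabla$ be its Levi-Civita connection, $s$ its scalar curvature, and let $a_\mu$ be the complex 1-form defined in the context. Define the operator on smooth complex functions $$\mathcal{O}_k\Phi=-(\nabla^\alpha+{\rm i}k a^\alpha)(\nabla_\alpha+{\rm i}k a_\alpha)\Phi+\frac{1+2k^2}{6}\,s\,\Phi,$$ (indices raised with $g$), and let $\mathcal{O}^T_k$ be the spin-$k$ Teukolsky operator $$\mathcal{O}_k^T = \Big[\tfrac{(r^2 + a^2)^2}{\Delta} - a^2 \sin^2\theta\Big]\partial_t^2 + \tfrac{4Mar}{\Delta}\partial_t \partial_\phi + \Big[\tfrac{a^2}{\Delta} - \tfrac{1}{\sin^2\theta}\Big]\partial_\phi^2 - \Delta^{-k}\partial_r ( \Delta^{k+1}\partial_r ) - \tfrac{1}{\sin\theta}\partial_\theta ( \sin\theta\, \partial_\theta ) - 2k \Big[ \tfrac{M(r^2 - a^2)}{\Delta}- r + {\rm i} a \cos\theta \Big]\partial_t - 2k \Big[\tfrac{a(r-M)}{\Delta} - \tfrac{{\rm i}\cos\theta}{\sin^2\theta} \Big]\partial_\phi + \left(k^2 \cot^2\theta - k\right).$$ Then, as operators on smooth complex functions on $\mathcal{U}$, $$\mathcal{O}^T_k = \frac{\lambda_+}{\lambda_-}\,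 \frac{\lambda_+}{\Delta^{k/2}}\, \mathcal{O}_k \circ \frac{\Delta^{k/2}}{\lambda_+},$$ i.e. $\mathcal{O}^T_k\Phi=\frac{\lambda_+}{\lambda_-}\frac{\lambda_+}{\Delta^{k/2}}\,\mathcal{O}_k\!\left(\frac{\Delta^{k/2}}{\lambda_+}\Phi\right)$ for all $\Phi$.
   Context: Coordinates $(t,r,q,\phi)$, $q=\cos\theta$. Set $C(r)=\Delta(r)=r^2-2Mr+a^2$, $D(q)=1-q^2=\sin^2\theta$, $\rho^2=r^2+a^2q^2$, $A=dt-a(1-q^2)\,d\phi$, $B=a\,dt-(r^2+a^2)\,d\phi$. The Kerr metric is $g_{Kerr}=-\frac{C}{\rho^2}A^2+\frac{\rho^2}{C}dr^2+\frac{\rho^2}{D}dq^2+\frac{D}{\rho^2}B^2$. Define $\lambda_\pm=\frac{1}{r\pm{\rm i}aq}$ (so $\rho^2=(\lambda_+\lambda_-)^{-1}$) and the complex-valued metric $g=\lambda_+^2 g_{Kerr}$; its Levi-Civita connection and scalar curvature are computed by the usual formulas (complex-valued). The 1-form $a$ is $$a={\rm i}\,\frac{C}{\rho^2}\Big(\frac{C_r}{2C}-2\lambda_+\Big)A-\frac{D}{\rho^2}\Big(\frac{D_q}{2D}-2{\rm i}a\lambda_+\Big)B,$$ where $C_r=\partial_rC$, $D_q=\partial_qD$ (equivalently, $a=J\,d\log(\sqrt{CD}\,\lambda_+^2)$ with $J$ the endomorphism obtained from the 2-form ${\rm i}A\wedge dr-B\wedge dq$ by raising an index with $g_{Kerr}$).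 In $(\nabla_\alpha+{\rm i}ka_\alpha)$ applied to a function $\Phi$ one gets the 1-form $\partial_\alpha\Phi+{\rm i}ka_\alpha\Phi$, and $(\nabla^\alpha+{\rm i}ka^\alpha)$ applied to a 1-form $v_\alpha$ gives $\nabla^\alpha v_\alpha+{\rm i}ka^\alpha v_\alpha$.
   Formalization: The region U is taken without the ring singularity r=0, q=0 (ρ²=0), which lies in U when a≠0 but where λ₊ and the Kerr metric are undefined; the identity is proved at all other points of U. *)

theory Defs
  imports "HOL-Analysis.Analysis"
begin

text \<open>Points of the coordinate chart are vectors x :: real^4 with
  x$1 = t, x$2 = r, x$3 = q (= cos theta), x$4 = phi.
  For the Teukolsky operator we use the chart (t, r, theta, phi), with y$3 = theta.\<close>

type_synonym pt = "real^4"

definition pd :: "4 \<Rightarrow> (pt \<Rightarrow> 'b::real_normed_vector) \<Rightarrow> pt \<Rightarrow> 'b" where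
  "pd i F x = vector_derivative (\<lambda>s::real. F (x + s *\<^sub>R axis i 1)) (at 0)"

fun pds :: "4 list \<Rightarrow> (pt \<Rightarrow> 'b::real_normed_vector) \<Rightarrow> pt \<Rightarrow> 'b" where
  "pds [] F = F"
| "pds (i # is) F = pd i (pds is F)"

definition smooth_on :: "pt set \<Rightarrow> (pt \<Rightarrow> complex) \<Rightarrow> bool" where
  "smooth_on U F \<longleftrightarrow> (\<forall>is. \<forall>x\<in>U. pds is F differentiable (at x))"

definition Delta :: "real \<Rightarrow> real \<Rightarrow> real \<Rightarrow> real" where
  "Delta M a r = r^2 - 2*M*r + a^2"

definition Dfun :: "real \<Rightarrow> real" where
  "Dfun q = 1 - q^2"

definition rho2 :: "real \<Rightarrow> real \<Rightarrow> real \<Rightarrow> real" where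
  "rho2 a r q = r^2 + a^2 * q^2"

definition lamp :: "real \<Rightarrow> pt \<Rightarrow> complex" where
  "lamp a x = 1 / (complex_of_real (x$2) + \<i> * complex_of_real (a * x$3))"

definition lamm :: "real \<Rightarrow> pt \<Rightarrow> complex" where
  "lamm a x = 1 / (complex_of_real (x$2) - \<i> * complex_of_real (a * x$3))"

text \<open>Components of the 1-forms A = dt - a(1-q^2) dphi and B = a dt - (r^2+a^2) dphi.\<close>
definition Aco :: "real \<Rightarrow> pt \<Rightarrow> 4 \<Rightarrow> real" where
  "Aco a x i = (if i = 1 then 1 else if i = 4 then - a * Dfun (x$3) else 0)"

definition Bco :: "real \<Rightarrow> pt \<Rightarrow> 4 \<Rightarrow> real" where
  "Bco a x i = (if i = 1 then a else if i = 4 then - ((x$2)^2 + a^2) else 0)"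

definition gKerr :: "real \<Rightarrow> real \<Rightarrow> pt \<Rightarrow> 4 \<Rightarrow> 4 \<Rightarrow> real" where
  "gKerr M a x i j =
     - (Delta M a (x$2) / rho2 a (x$2) (x$3)) * Aco a x i * Aco a x j
     + (rho2 a (x$2) (x$3) / Delta M a (x$2)) * (if i = 2 \<and> j = 2 then 1 else 0)
     + (rho2 a (x$2) (x$3) / Dfun (x$3)) * (if i = 3 \<and> j = 3 then 1 else 0)
     + (Dfun (x$3) / rho2 a (x$2) (x$3)) * Bco a x i * Bco a x j"

definition gmet :: "real \<Rightarrow> real \<Rightarrow> pt \<Rightarrow> 4 \<Rightarrow> 4 \<Rightarrow> complex" where
  "gmet M a x i j = (lamp a x)^2 * complex_of_real (gKerr M a x i j)"

definition ginv :: "real \<Rightarrow> real \<Rightarrow> pt \<Rightarrow> 4 \<Rightarrow> 4 \<Rightarrow> complex" where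
  "ginv M a x i j = matrix_inv (\<chi> i j. gmet M a x i j) $ i $ j"

definition Gam :: "real \<Rightarrow> real \<Rightarrow> pt \<Rightarrow> 4 \<Rightarrow> 4 \<Rightarrow> 4 \<Rightarrow> complex" where
  "Gam M a x c i j = (1/2) * (\<Sum>d\<in>UNIV. ginv M a x c d *
      (pd i (\<lambda>y. gmet M a y d j) x + pd j (\<lambda>y. gmet M a y d i) x - pd d (\<lambda>y. gmet M a y i j) x))"

definition Riem :: "real \<Rightarrow> real \<Rightarrow> pt \<Rightarrow> 4 \<Rightarrow> 4 \<Rightarrow> 4 \<Rightarrow> 4 \<Rightarrow> complex" where
  "Riem M a x r s m n =
     pd m (\<lambda>y. Gam M a y r n s) x - pd n (\<lambda>y. Gam M a y r m s) x
     + (\<Sum>l\<in>UNIV. Gam M a x r m l * Gam M a x l n s - Gam M a x r n l * Gam M a x l m s)"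

definition Ric :: "real \<Rightarrow> real \<Rightarrow> pt \<Rightarrow> 4 \<Rightarrow> 4 \<Rightarrow> complex" where
  "Ric M a x s n = (\<Sum>r\<in>UNIV. Riem M a x r s r n)"

definition scal :: "real \<Rightarrow> real \<Rightarrow> pt \<Rightarrow> complex" where
  "scal M a x = (\<Sum>s\<in>UNIV. \<Sum>n\<in>UNIV. ginv M a x s n * Ric M a x s n)"

definition aform :: "real \<Rightarrow> real \<Rightarrow> pt \<Rightarrow> 4 \<Rightarrow> complex" where
  "aform M a x i =
     \<i> * complex_of_real (Delta M a (x$2) / rho2 a (x$2) (x$3))
       * (complex_of_real (deriv (Delta M a) (x$2) / (2 * Delta M a (x$2))) - 2 * lamp a x)
       * complex_of_real (Aco a x i)
     - complex_of_real (Dfun (x$3) / rho2 a (x$2) (x$3))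
       * (complex_of_real (deriv Dfun (x$3) / (2 * Dfun (x$3))) - 2 * \<i> * complex_of_real a * lamp a x)
       * complex_of_real (Bco a x i)"

definition covD :: "real \<Rightarrow> real \<Rightarrow> real \<Rightarrow> (pt \<Rightarrow> complex) \<Rightarrow> pt \<Rightarrow> 4 \<Rightarrow> complex" where
  "covD M a k F x j = pd j F x + \<i> * complex_of_real k * aform M a x j * F x"

text \<open>O_k Phi = -(nabla^i + i k a^i)(nabla_i + i k a_i) Phi + (1+2k^2)/6 s Phi, where for a
  1-form v: (nabla^i + i k a^i) v_i = g^{ij} (d_i v_j - Gamma^l_{ij} v_l + i k a_i v_j).\<close>
definition Oop :: "real \<Rightarrow> real \<Rightarrow> real \<Rightarrow> (pt \<Rightarrow> complex) \<Rightarrow> pt \<Rightarrow> complex" where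
  "Oop M a k F x =
     - (\<Sum>i\<in>UNIV. \<Sum>j\<in>UNIV. ginv M a x i j *
          (pd i (\<lambda>y. covD M a k F y j) x
           - (\<Sum>l\<in>UNIV. Gam M a x l i j * covD M a k F x l)
           + \<i> * complex_of_real k * aform M a x i * covD M a k F x j))
     + complex_of_real ((1 + 2 * k^2) / 6) * scal M a x * F x"

definition Teuk :: "real \<Rightarrow> real \<Rightarrow> real \<Rightarrow> (pt \<Rightarrow> complex) \<Rightarrow> pt \<Rightarrow> complex" where
  "Teuk M a k P y =
     (let r = y$2; th = y$3; Dl = Delta M a r in
       complex_of_real (((r^2 + a^2)^2 / Dl) - a^2 * (sin th)^2) * pd 1 (pd 1 P) y
     + complex_of_real (4 * M * a * r / Dl) * pd 1 (pd 4 P) y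
     + complex_of_real (a^2 / Dl - 1 / (sin th)^2) * pd 4 (pd 4 P) y
     - complex_of_real (Dl powr (-k)) *
         pd 2 (\<lambda>z. complex_of_real (Delta M a (z$2) powr (k + 1)) * pd 2 P z) y
     - complex_of_real (1 / sin th) *
         pd 3 (\<lambda>z. complex_of_real (sin (z$3)) * pd 3 P z) y
     - 2 * complex_of_real k * (complex_of_real (M * (r^2 - a^2) / Dl - r) + \<i> * complex_of_real (a * cos th))
         * pd 1 P y
     - 2 * complex_of_real k * (complex_of_real (a * (r - M) / Dl) - \<i> * complex_of_real (cos th / (sin th)^2))
         * pd 4 P y
     + complex_of_real (k^2 * (cot th)^2 - k) * P y)"

end

theory Submission
  imports Defs "HOL-Complex_Analysis.Cauchy_Integral_Formula"
begin

text \<open>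
  The complex metric is block diagonal: a block \<open>h\<close> in \<open>(t, \<phi>)\<close> and a diagonal block in \<open>(r, q)\<close>,
  all depending on \<open>(r, q)\<close> only. Writing \<open>z = r + iaq\<close> and \<open>w = r - iaq\<close> for the reciprocals of \<open>\<lambda>\<^sub>+\<close> and
  \<open>\<lambda>\<^sub>-\<close>, one has \<open>det h = -CD/z\<^sup>4\<close>. For such a metric the second derivatives of \<open>h\<close> enter the scalar
  curvature only through \<open>det h\<close>, its remaining contribution being \<open>det (\<partial>\<^sub>i h)\<close>, and the curvature
  collapses to \<open>12 M \<lambda>\<^sub>+\<close>. The contracted Christoffel symbols are logarithmic derivatives of the volume
  factor, \<open>a\<close> is divergence free, and its square is
  \<open>(z/w) (C'\<^sup>2/4C + q\<^sup>2/D - 4Mw/z\<^sup>2)\<close>. After conjugation by \<open>C\<^bsup>k/2\<^esup> z\<close> the term \<open>C'\<^sup>2/4C\<close> is absorbed, and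
  the multiples of \<open>Mw/z\<^sup>2\<close> cancel against the curvature term exactly because of the factor \<open>(1 + 2k\<^sup>2)/6\<close>;
  what is left is the Teukolsky operator in the variable \<open>q = cos \<theta>\<close>.
\<close>

subsection \<open>Partial derivatives\<close>

text \<open>The obstacle is the size of the curvature. It is expanded with the entries of
  \<open>h\<close> and their derivatives as independent symbols; explicit entries are inserted only
  afterwards. Their second derivatives come from differentiating \<open>log det h\<close> twice, and
  \<open>det (h')\<close> needs first derivatives only. The determinant is simple because
  \<open>h\<close> is diagonal in the coframe A, B, and A wedge B is minus \<open>zw\<close> times
  dt wedge dphi. The form \<open>a\<close> is divergence free because it has only dt and dphi
  components, whose coefficients depend on r and q alone. The factor (1 + 2k^2)/6 turns the
  curvature into (z/w)(1 + 2k^2) 2Mw/z^2. Here the summand 2k^2 offsets the -4k^2 Mw/z^2 contained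
  in k^2 times the square of \<open>a\<close>, and the summand 1 offsets the -2Mw/z^2 that
  conjugation by z leaves behind even for k = 0. Conjugation by z also removes the first-order terms
  -2C/z and -2iaD/z caused by the conformal factor, while C^(k/2) turns C' into (k+1)C'.\<close>

text \<open>\<open>pd\<close> rests on the choice operator in \<open>vector_derivative\<close>, so
  it obeys sum and product rules only where the derivative exists; this relation carries existence
  along with the value.\<close>

definition has_pd :: "4 \<Rightarrow> (pt \<Rightarrow> 'b::real_normed_vector) \<Rightarrow> 'b \<Rightarrow> pt \<Rightarrow> bool" where
  "has_pd i F d x \<longleftrightarrow> ((\<lambda>s::real. F (x + s *\<^sub>R axis i 1)) has_vector_derivative d) (at 0)"

lemma has_pd_imp_pd: "has_pd i F d x \<Longrightarrow> pd i F x = d"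
  unfolding has_pd_def pd_def by (rule vector_derivative_at)

text \<open>The parameter s is arbitrary, not just 0: the mean value arguments behind
  \<open>pd_commute\<close> need the derivative all along a coordinate line.\<close>

lemma differentiable_imp_has_pd_line:
  fixes F :: "pt \<Rightarrow> 'b::real_normed_vector"
  assumes "F differentiable (at (x + s *\<^sub>R axis i 1))"
  shows "((\<lambda>s. F (x + s *\<^sub>R axis i 1)) has_vector_derivative pd i F (x + s *\<^sub>R axis i 1)) (at s)"
proof -
  let ?e = "axis i 1 :: pt"
  from assms obtain F' where F': "(F has_derivative F') (at (x + s *\<^sub>R ?e))"
    unfolding differentiable_def by blast
  have line: "((\<lambda>s. x + s *\<^sub>R ?e) has_derivative (\<lambda>h. h *\<^sub>R ?e)) (at s)" for s and x :: pt
    by (auto intro!: derivative_eq_intros)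
  interpret F': bounded_linear F' using F' by (rule has_derivative_bounded_linear)
  have 1: "((\<lambda>s. F (x + s *\<^sub>R ?e)) has_vector_derivative F' ?e) (at s)"
    unfolding has_vector_derivative_def
    using has_derivative_compose[OF line F'] by (simp add: F'.scaleR)
  have "((\<lambda>u. F ((x + s *\<^sub>R ?e) + u *\<^sub>R ?e)) has_derivative (\<lambda>h. F' (h *\<^sub>R ?e))) (at 0)"
    using has_derivative_compose[OF line[of "x + s *\<^sub>R ?e" 0], of F F'] F' by simp
  then have "has_pd i F (F' ?e) (x + s *\<^sub>R ?e)"
    unfolding has_pd_def has_vector_derivative_def by (simp add: F'.scaleR)
  then show ?thesis using 1 has_pd_imp_pd by metis
qed

lemma differentiable_imp_has_pd:
  "F differentiable (at x) \<Longrightarrow> has_pd i F (pd i F x) x"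
  unfolding has_pd_def using differentiable_imp_has_pd_line[of F x 0 i] by simp

lemma has_pd_add: "has_pd i F d x \<Longrightarrow> has_pd i G e x \<Longrightarrow> has_pd i (\<lambda>y. F y + G y) (d + e) x"
  unfolding has_pd_def by (rule has_vector_derivative_add)

lemma has_pd_mult:
  fixes F G :: "pt \<Rightarrow> complex"
  shows "has_pd i F d x \<Longrightarrow> has_pd i G e x \<Longrightarrow> has_pd i (\<lambda>y. F y * G y) (F x * e + d * G x) x"
  unfolding has_pd_def by (drule (1) has_vector_derivative_mult) simp

text \<open>Closed forms of metric and connection hold only on the chart domain; its openness is
  what allows them to be differentiated.\<close>

lemma has_pd_cong_open:
  assumes "open U" "x \<in> U" "\<And>y. y \<in> U \<Longrightarrow> F y = G y"
  shows "has_pd i F d x \<longleftrightarrow> has_pd i G d x"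
proof -
  have "((\<lambda>s::real. x + s *\<^sub>R axis i 1) \<longlongrightarrow> x + 0 *\<^sub>R axis i 1) (nhds 0)"
    by (intro tendsto_intros filterlim_ident)
  then have "\<forall>\<^sub>F s in nhds (0::real). x + s *\<^sub>R axis i 1 \<in> U"
    using assms(1,2) by (auto intro: topological_tendstoD)
  then have ev: "\<forall>\<^sub>F s in nhds (0::real). F (x + s *\<^sub>R axis i 1) = G (x + s *\<^sub>R axis i 1)"
    by eventually_elim (use assms(3) in auto)
  show ?thesis unfolding has_pd_def
    using ev by (intro has_vector_derivative_cong_ev) (auto dest: eventually_nhds_x_imp_x elim: eventually_mono)
qed

text \<open>Requires no differentiability: both sides choose from the same predicate, so they agree
  even when no derivative exists.\<close>

lemma pd_cong_open:
  assumes "open U" "x \<in> U" "\<And>y. y \<in> U \<Longrightarrow> F y = G y"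
  shows "pd i F x = pd i G x"
  using has_pd_cong_open[OF assms(1,2), of F G] assms(3)
  unfolding pd_def has_pd_def vector_derivative_def by simp

section \<open>Symmetry of mixed partial derivatives\<close>

text \<open>The mean value theorem is applied twice: in s to the increment
  \<open>g s h - g s 0\<close>, then in t to \<open>gx s\<close>.\<close>

lemma second_difference_mvt:
  fixes g :: "real \<Rightarrow> real \<Rightarrow> real"
  assumes h: "0 < h" "h < e"
    and gx: "\<And>s t. \<bar>s\<bar> < e \<Longrightarrow> \<bar>t\<bar> < e \<Longrightarrow> ((\<lambda>s. g s t) has_real_derivative gx s t) (at s)"
    and gxy: "\<And>s t. \<bar>s\<bar> < e \<Longrightarrow> \<bar>t\<bar> < e \<Longrightarrow> ((\<lambda>t. gx s t) has_real_derivative gxy s t) (at t)"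
  obtains s t where "0 < s" "s < h" "0 < t" "t < h"
    "g h h - g h 0 - g 0 h + g 0 0 = h * h * gxy s t"
proof -
  have "\<exists>s. 0 < s \<and> s < h \<and> (g h h - g h 0) - (g 0 h - g 0 0) = (h - 0) * (gx s h - gx s 0)"
    using h by (intro MVT2[of 0 h "\<lambda>s. g s h - g s 0" "\<lambda>s. gx s h - gx s 0"])
      (auto intro!: derivative_eq_intros gx)
  then obtain s where s: "0 < s" "s < h" "(g h h - g h 0) - (g 0 h - g 0 0) = h * (gx s h - gx s 0)"
    by auto
  have "\<exists>t. 0 < t \<and> t < h \<and> gx s h - gx s 0 = (h - 0) * gxy s t"
    using h s by (intro MVT2[of 0 h "gx s" "gxy s"]) (auto intro!: gxy)
  then obtain t where "0 < t" "t < h" "gx s h - gx s 0 = h * gxy s t" by auto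
  with s show ?thesis by (intro that[of s t]) (auto simp: algebra_simps)
qed

text \<open>Schwarz's theorem. The second difference over a square is symmetric in the two
  variables, so it equals h^2 times a value of either mixed derivative; continuity at the origin
  then forces equality there.\<close>

lemma mixed_partials_eq_real:
  fixes g :: "real \<Rightarrow> real \<Rightarrow> real"
  assumes e: "0 < e"
    and gx: "\<And>s t. \<bar>s\<bar> < e \<Longrightarrow> \<bar>t\<bar> < e \<Longrightarrow> ((\<lambda>s. g s t) has_real_derivative gx s t) (at s)"
    and gy: "\<And>s t. \<bar>s\<bar> < e \<Longrightarrow> \<bar>t\<bar> < e \<Longrightarrow> ((\<lambda>t. g s t) has_real_derivative gy s t) (at t)"
    and gxy: "\<And>s t. \<bar>s\<bar> < e \<Longrightarrow> \<bar>t\<bar> < e \<Longrightarrow> ((\<lambda>t. gx s t) has_real_derivative gxy s t) (at t)"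
    and gyx: "\<And>s t. \<bar>s\<bar> < e \<Longrightarrow> \<bar>t\<bar> < e \<Longrightarrow> ((\<lambda>s. gy s t) has_real_derivative gyx s t) (at s)"
    and c1: "isCont (\<lambda>p. gxy (fst p) (snd p)) (0, 0)"
    and c2: "isCont (\<lambda>p. gyx (fst p) (snd p)) (0, 0)"
  shows "gxy 0 0 = gyx 0 0"
proof (rule ccontr)
  assume ne: "gxy 0 0 \<noteq> gyx 0 0"
  define \<epsilon> where "\<epsilon> = \<bar>gxy 0 0 - gyx 0 0\<bar> / 2"
  have \<epsilon>: "\<epsilon> > 0" using ne by (simp add: \<epsilon>_def)
  from c1 \<epsilon> obtain d1 where d1: "d1 > 0"
    "\<And>p. dist p (0, 0) < d1 \<Longrightarrow> dist (gxy (fst p) (snd p)) (gxy 0 0) < \<epsilon>"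
    unfolding continuous_at_eps_delta by fastforce
  from c2 \<epsilon> obtain d2 where d2: "d2 > 0"
    "\<And>p. dist p (0, 0) < d2 \<Longrightarrow> dist (gyx (fst p) (snd p)) (gyx 0 0) < \<epsilon>"
    unfolding continuous_at_eps_delta by fastforce
  \<comment> \<open>Points of the square satisfy |s| + |t| < 2h, so 2h has to stay below both
    continuity radii.\<close>
  define h where "h = min e (min d1 d2) / 2"
  have h: "0 < h" "h < e" "2 * h \<le> d1" "2 * h \<le> d2" using e d1 d2 by (auto simp: h_def)
  have near: "dist (s, t) (0::real, 0::real) < 2 * h" if "0 < s" "s < h" "0 < t" "t < h" for s t
    using sqrt_sum_squares_le_sum_abs[of s t] that by (simp add: dist_Pair_Pair)
  obtain s t where st: "0 < s" "s < h" "0 < t" "t < h"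
    "g h h - g h 0 - g 0 h + g 0 0 = h * h * gxy s t"
    using second_difference_mvt[OF h(1,2), of g gx gxy] gx gxy by blast
  obtain t' s' where st': "0 < t'" "t' < h" "0 < s'" "s' < h"
    "g h h - g 0 h - g h 0 + g 0 0 = h * h * gyx s' t'"
    using second_difference_mvt[OF h(1,2), of "\<lambda>t s. g s t" "\<lambda>t s. gy s t" "\<lambda>t s. gyx s t"] gy gyx by blast
  have "h * h * gxy s t = h * h * gyx s' t'" using st(5) st'(5) by linarith
  then have "gxy s t = gyx s' t'" using h(1) by simp
  moreover have "dist (gxy s t) (gxy 0 0) < \<epsilon>" using d1(2)[of "(s, t)"] near[OF st(1-4)] h by simp
  moreover have "dist (gyx s' t') (gyx 0 0) < \<epsilon>"
    using d2(2)[of "(s', t')"] near[OF st'(3,4,1,2)] h by simp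
  ultimately show False using \<epsilon>_def by (simp add: dist_real_def abs_if split: if_splits)
qed

lemma smooth_on_imp_differentiable: "smooth_on U F \<Longrightarrow> x \<in> U \<Longrightarrow> F differentiable (at x)"
  unfolding smooth_on_def by (metis pds.simps(1))

lemma smooth_on_pd: "smooth_on U F \<Longrightarrow> smooth_on U (pd i F)"
proof -
  have "pds is (pd i F) = pds (is @ [i]) F" for "is" by (induction "is") auto
  then show "smooth_on U F \<Longrightarrow> smooth_on U (pd i F)" unfolding smooth_on_def by auto
qed

text \<open>Needed because the covariant operator produces both orders of the t and phi derivatives,
  the Teukolsky operator only one. Continuity of the second derivatives comes from
  \<open>smooth_on\<close>, which makes every iterated partial differentiable.\<close>

lemma pd_commute:
  fixes F :: "pt \<Rightarrow> complex"
  assumes U: "open U" "x \<in> U" and F: "smooth_on U F"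
  shows "pd i (pd j F) x = pd j (pd i F) x"
proof -
  obtain \<epsilon> where \<epsilon>: "\<epsilon> > 0" "ball x \<epsilon> \<subseteq> U" using U open_contains_ball by metis
  let ?P = "\<lambda>s t. x + s *\<^sub>R axis i 1 + t *\<^sub>R axis j 1 :: pt"
  define e where "e = \<epsilon> / 2"
  have e: "e > 0" using \<epsilon> by (simp add: e_def)
  have PU: "?P s t \<in> U" if "\<bar>s\<bar> < e" "\<bar>t\<bar> < e" for s t
  proof -
    have "norm (s *\<^sub>R axis i 1 + t *\<^sub>R axis j 1 :: pt) \<le> \<bar>s\<bar> + \<bar>t\<bar>"
      by (rule norm_triangle_le) (simp add: norm_axis_1)
    moreover have "x - ?P s t = - (s *\<^sub>R axis i 1 + t *\<^sub>R axis j 1)" by simp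
    ultimately have "dist x (?P s t) < \<epsilon>"
      using that unfolding dist_norm e_def by (simp only: norm_minus_cancel)
    then show ?thesis using \<epsilon> by auto
  qed
  have di: "((\<lambda>s. G (?P s t)) has_vector_derivative pd i G (?P s t)) (at s)"
    if "smooth_on U G" "\<bar>s\<bar> < e" "\<bar>t\<bar> < e" for G s t
    using differentiable_imp_has_pd_line[of G "x + t *\<^sub>R axis j 1" s i]
      smooth_on_imp_differentiable[OF that(1) PU[OF that(2,3)]] by (simp add: algebra_simps)
  have dj: "((\<lambda>t. G (?P s t)) has_vector_derivative pd j G (?P s t)) (at t)"
    if "smooth_on U G" "\<bar>s\<bar> < e" "\<bar>t\<bar> < e" for G s t
    using differentiable_imp_has_pd_line[of G "x + s *\<^sub>R axis i 1" t j]
      smooth_on_imp_differentiable[OF that(1) PU[OF that(2,3)]] by (simp add: algebra_simps)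
  have cont: "isCont (\<lambda>p. G (?P (fst p) (snd p))) (0, 0)" if "smooth_on U G" for G
  proof -
    have "isCont G (?P (fst (0::real, 0::real)) (snd (0::real,0::real)))"
      using differentiable_imp_continuous_within smooth_on_imp_differentiable[OF that U(2)] by auto
    then show ?thesis by (intro isCont_o2[of _ "\<lambda>p. ?P (fst p) (snd p)" G] continuous_intros)
  qed
  note Fi = smooth_on_pd[OF F, of i] and Fj = smooth_on_pd[OF F, of j]
  note Fij = smooth_on_pd[OF Fi, of j] and Fji = smooth_on_pd[OF Fj, of i]
  \<comment> \<open>The mean value theorem is a real statement, hence the split into real and
    imaginary parts.\<close>
  have "Re (pd j (pd i F) (?P 0 0)) = Re (pd i (pd j F) (?P 0 0))"
    by (rule mixed_partials_eq_real[OF e,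
          where g = "\<lambda>s t. Re (F (?P s t))" and gx = "\<lambda>s t. Re (pd i F (?P s t))"
          and gy = "\<lambda>s t. Re (pd j F (?P s t))" and gxy = "\<lambda>s t. Re (pd j (pd i F) (?P s t))"
          and gyx = "\<lambda>s t. Re (pd i (pd j F) (?P s t))"])
      (auto intro!: continuous_Re continuous_Im cont di dj F Fi Fj Fij Fji bounded_linear.has_vector_derivative[OF bounded_linear_Re]
         simp: has_real_derivative_iff_has_vector_derivative)
  moreover have "Im (pd j (pd i F) (?P 0 0)) = Im (pd i (pd j F) (?P 0 0))"
    by (rule mixed_partials_eq_real[OF e,
          where g = "\<lambda>s t. Im (F (?P s t))" and gx = "\<lambda>s t. Im (pd i F (?P s t))"
          and gy = "\<lambda>s t. Im (pd j F (?P s t))" and gxy = "\<lambda>s t. Im (pd j (pd i F) (?P s t))"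
          and gyx = "\<lambda>s t. Im (pd i (pd j F) (?P s t))"])
      (auto intro!: continuous_Re continuous_Im cont di dj F Fi Fj Fij Fji bounded_linear.has_vector_derivative[OF bounded_linear_Im]
         simp: has_real_derivative_iff_has_vector_derivative)
  ultimately show ?thesis by (simp add: complex_eq_iff)
qed

section \<open>Coordinate functions of (r, q) continued to complex arguments\<close>

lemma has_pd_rq:
  fixes f :: "complex \<Rightarrow> complex \<Rightarrow> complex"
  shows has_pd_rq_1: "has_pd 1 (\<lambda>y. f (of_real (y$2)) (of_real (y$3))) 0 x"
    and has_pd_rq_4: "has_pd 4 (\<lambda>y. f (of_real (y$2)) (of_real (y$3))) 0 x"
    and has_pd_rq_2: "((\<lambda>r. f r (of_real (x$3))) has_field_derivative d) (at (of_real (x$2))) \<Longrightarrow>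
          has_pd 2 (\<lambda>y. f (of_real (y$2)) (of_real (y$3))) d x"
    and has_pd_rq_3: "((\<lambda>q. f (of_real (x$2)) q) has_field_derivative d) (at (of_real (x$3))) \<Longrightarrow>
          has_pd 3 (\<lambda>y. f (of_real (y$2)) (of_real (y$3))) d x"
proof -
  show "has_pd 1 (\<lambda>y. f (of_real (y$2)) (of_real (y$3))) 0 x"
    "has_pd 4 (\<lambda>y. f (of_real (y$2)) (of_real (y$3))) 0 x"
    by (simp_all add: has_pd_def axis_def)
  have shift: "((\<lambda>s. h (of_real (c + s))) has_vector_derivative d) (at 0)"
    if "(h has_field_derivative d) (at (of_real c))" for h :: "complex \<Rightarrow> complex" and c
  proof -
    have "((\<lambda>s. h (of_real s)) has_vector_derivative d) (at (c + 0))"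
      using that by (simp add: has_vector_derivative_real_field)
    moreover have "((\<lambda>s::real. c + s) has_vector_derivative 1) (at 0)"
      by (auto intro!: derivative_eq_intros)
    ultimately show ?thesis
      using vector_diff_chain_at[of "\<lambda>s. c + s" 1 0 "\<lambda>s. h (of_real s)" d] by (simp add: o_def)
  qed
  show "has_pd 2 (\<lambda>y. f (of_real (y$2)) (of_real (y$3))) d x"
    if "((\<lambda>r. f r (of_real (x$3))) has_field_derivative d) (at (of_real (x$2)))"
    using shift[OF that] by (simp add: has_pd_def axis_def)
  show "has_pd 3 (\<lambda>y. f (of_real (y$2)) (of_real (y$3))) d x"
    if "((\<lambda>q. f (of_real (x$2)) q) has_field_derivative d) (at (of_real (x$3)))"
    using shift[OF that] by (simp add: has_pd_def axis_def)
qed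

subsection \<open>The metric and its inverse\<close>

lemma matrix_inv_eqI:
  fixes A B :: "'a::comm_ring_1^'n^'n"
  assumes "A ** B = mat 1" "B ** A = mat 1"
  shows "matrix_inv A = B"
proof -
  have "A ** matrix_inv A = mat 1 \<and> matrix_inv A ** A = mat 1"
    unfolding matrix_inv_def by (rule someI[of _ B]) (use assms in simp)
  then show ?thesis
    by (metis assms(2) matrix_mul_assoc matrix_mul_lid matrix_mul_rid)
qed

lemma four_distinct [simp]:
  "(1::4) \<noteq> 2" "(1::4) \<noteq> 3" "(1::4) \<noteq> 4" "(2::4) \<noteq> 1" "(2::4) \<noteq> 3" "(2::4) \<noteq> 4"
  "(3::4) \<noteq> 1" "(3::4) \<noteq> 2" "(3::4) \<noteq> 4" "(4::4) \<noteq> 1" "(4::4) \<noteq> 2" "(4::4) \<noteq> 3"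
  by simp_all

locale kerr =
  fixes M a :: real
begin

text \<open>The condition on \<open>rho2\<close> removes the ring r = q = 0, where for nonzero a one
  has Delta = a^2 > 0 although the metric is singular.\<close>

definition U :: "pt set" where
  "U = {y. Delta M a (y$2) > 0 \<and> -1 < y$3 \<and> y$3 < 1 \<and> rho2 a (y$2) (y$3) \<noteq> 0}"

text \<open>\<open>r\<close> and \<open>q\<close> are taken complex from here on: holomorphy then supplies the higher derivatives of the
  metric coefficients without computing them.\<close>

definition z :: "complex \<Rightarrow> complex \<Rightarrow> complex" where "z r q = r + \<i> * of_real a * q"
definition w :: "complex \<Rightarrow> complex \<Rightarrow> complex" where "w r q = r - \<i> * of_real a * q"
definition C :: "complex \<Rightarrow> complex" where "C r = r^2 - 2 * of_real M * r + of_real a ^ 2"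
definition D :: "complex \<Rightarrow> complex" where "D q = 1 - q^2"

definition reg :: "complex \<Rightarrow> complex \<Rightarrow> bool" where
  "reg r q \<longleftrightarrow> z r q \<noteq> 0 \<and> w r q \<noteq> 0 \<and> C r \<noteq> 0 \<and> D q \<noteq> 0"

text \<open>The block \<open>(-C A\<^sub>i A\<^sub>j + D B\<^sub>i B\<^sub>j) / (z\<^sup>3 w)\<close>, with \<open>C - (r\<^sup>2 + a\<^sup>2) = -2Mr\<close> used in the mixed entry.\<close>

definition h11 :: "complex \<Rightarrow> complex \<Rightarrow> complex" where
  "h11 r q = (of_real a ^ 2 * D q - C r) / (z r q ^ 3 * w r q)"
definition h14 :: "complex \<Rightarrow> complex \<Rightarrow> complex" where
  "h14 r q = - 2 * of_real M * r * of_real a * D q / (z r q ^ 3 * w r q)"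
definition h44 :: "complex \<Rightarrow> complex \<Rightarrow> complex" where
  "h44 r q = D q * ((r^2 + of_real a ^ 2)^2 - of_real a ^ 2 * C r * D q) / (z r q ^ 3 * w r q)"
definition e2 :: "complex \<Rightarrow> complex \<Rightarrow> complex" where "e2 r q = w r q / (z r q * C r)"
definition e3 :: "complex \<Rightarrow> complex \<Rightarrow> complex" where "e3 r q = w r q / (z r q * D q)"
definition hdet :: "complex \<Rightarrow> complex \<Rightarrow> complex" where
  "hdet r q = h11 r q * h44 r q - h14 r q * h14 r q"

definition kg :: "4 \<Rightarrow> 4 \<Rightarrow> complex \<Rightarrow> complex \<Rightarrow> complex" where
  "kg i j = (if i = 1 \<and> j = 1 then h11 else if i = 4 \<and> j = 4 then h44
     else if i = 1 \<and> j = 4 \<or> i = 4 \<and> j = 1 then h14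
     else if i = 2 \<and> j = 2 then e2 else if i = 3 \<and> j = 3 then e3 else (\<lambda>_ _. 0))"

definition kinv :: "4 \<Rightarrow> 4 \<Rightarrow> complex \<Rightarrow> complex \<Rightarrow> complex" where
  "kinv i j r q = (if i = 1 \<and> j = 1 then h44 r q / hdet r q else if i = 4 \<and> j = 4 then h11 r q / hdet r q
     else if i = 1 \<and> j = 4 \<or> i = 4 \<and> j = 1 then - h14 r q / hdet r q
     else if i = 2 \<and> j = 2 then 1 / e2 r q else if i = 3 \<and> j = 3 then 1 / e3 r q else 0)"

lemma open_U: "open U"
proof -
  have 1: "open {y::pt. 0 < Delta M a (y$2)}" "open {y::pt. -1 < y$3}" "open {y::pt. y$3 < 1}"
    unfolding Delta_def by (auto intro!: open_Collect_less continuous_intros)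
  have 2: "open {y::pt. rho2 a (y$2) (y$3) \<noteq> 0}"
    unfolding rho2_def by (intro open_Collect_neq continuous_intros)
  have "U = {y. 0 < Delta M a (y$2)} \<inter> {y. -1 < y$3} \<inter> {y. y$3 < 1} \<inter> {y. rho2 a (y$2) (y$3) \<noteq> 0}"
    by (auto simp: U_def)
  then show ?thesis using 1 2 by auto
qed

lemma of_real_Delta: "of_real (Delta M a r) = C (of_real r)"
  and of_real_Dfun: "of_real (Dfun q) = D (of_real q)"
  by (simp_all add: Delta_def Dfun_def C_def D_def)

lemma zw: "z r q * w r q = r^2 + of_real a ^ 2 * q^2"
  by (simp add: z_def w_def algebra_simps power2_eq_square)

lemma of_real_rho2: "of_real (rho2 a r q) = z (of_real r) (of_real q) * w (of_real r) (of_real q)"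
  by (simp add: zw rho2_def)

lemma lamp_eq: "lamp a y = 1 / z (of_real (y$2)) (of_real (y$3))"
  and lamm_eq: "lamm a y = 1 / w (of_real (y$2)) (of_real (y$3))"
  by (simp_all add: lamp_def lamm_def z_def w_def mult.assoc)

lemma U_reg: "y \<in> U \<Longrightarrow> reg (of_real (y$2)) (of_real (y$3))"
proof -
  assume y: "y \<in> U"
  have "of_real (rho2 a (y$2) (y$3)) \<noteq> (0::complex)" "of_real (Delta M a (y$2)) \<noteq> (0::complex)"
    using y by (auto simp: U_def)
  moreover have "(y$3)^2 < 1" using y by (simp add: U_def abs_square_less_1 abs_less_iff)
  then have "of_real (Dfun (y$3)) \<noteq> (0::complex)" by (simp only: of_real_eq_0_iff Dfun_def)
  ultimately show ?thesis unfolding of_real_rho2 of_real_Delta of_real_Dfun reg_def by auto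
qed

lemma gmet_eq:
  assumes "y \<in> U"
  shows "gmet M a y i j = kg i j (of_real (y$2)) (of_real (y$3))"
proof -
  define r q :: complex where rq: "r = of_real (y$2)" "q = of_real (y$3)"
  have nz: "z r q \<noteq> 0" "w r q \<noteq> 0" "C r \<noteq> 0" "D q \<noteq> 0"
    using U_reg[OF assms] by (auto simp: reg_def rq)
  have "C r = r^2 + of_real a ^ 2 - 2 * of_real M * r" by (simp add: C_def)
  then have c: "C r - (r^2 + of_real a ^ 2) = - 2 * of_real M * r" by simp
  have m: "h14 r q = (C r - (r^2 + of_real a ^ 2)) * of_real a * D q / (z r q ^ 3 * w r q)"
    unfolding h14_def c by simp
  have A: "of_real (Aco a y i) = (if i = 1 then 1 else if i = 4 then - of_real a * D q else 0)"
    and B: "of_real (Bco a y i) = (if i = 1 then of_real a else if i = 4 then - (r^2 + of_real a ^ 2) else 0)" for i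
    by (auto simp: Aco_def Bco_def rq of_real_Dfun)
  have "gmet M a y i j = (1 / z r q)^2 * (- (C r / (z r q * w r q)) * of_real (Aco a y i) * of_real (Aco a y j)
     + (z r q * w r q / C r) * (if i = 2 \<and> j = 2 then 1 else 0)
     + (z r q * w r q / D q) * (if i = 3 \<and> j = 3 then 1 else 0)
     + (D q / (z r q * w r q)) * of_real (Bco a y i) * of_real (Bco a y j))"
    unfolding gmet_def gKerr_def lamp_eq rq by (simp add: of_real_rho2 of_real_Delta of_real_Dfun)
  also have "\<dots> = kg i j r q"
    using exhaust_4[of i] exhaust_4[of j] nz unfolding A B
    by (elim disjE; simp add: kg_def h11_def h44_def m e2_def e3_def)
       (simp_all add: field_simps power2_eq_square power3_eq_cube)
  finally show ?thesis by (simp add: rq)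
qed

text \<open>In the coframe A, B the block is diagonal with entries -C and D over z^3 w, and the
  change of coframe to dt, dphi has determinant -(r^2 + a^2) + a^2 D = -zw. Hence the determinant is
  -CD (zw)^2 / (z^3 w)^2.\<close>

lemma hdet_eq: "reg r q \<Longrightarrow> hdet r q = - C r * D q / z r q ^ 4"
proof -
  assume "reg r q"
  then have nz: "z r q \<noteq> 0" "w r q \<noteq> 0" by (auto simp: reg_def)
  have "hdet r q = ((of_real a ^ 2 * D q - C r) * (D q * ((r^2 + of_real a ^ 2)^2 - of_real a ^ 2 * C r * D q))
      - (2 * of_real M * r * of_real a * D q)^2) / (z r q ^ 6 * w r q ^ 2)"
    using nz by (simp add: hdet_def h11_def h14_def h44_def field_simps) (simp add: eval_nat_numeral)
  also have "(2 * of_real M * r * of_real a * D q)^2 = (r^2 + of_real a ^ 2 - C r)^2 * of_real a ^ 2 * D q ^ 2"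
    by (simp add: C_def power2_eq_square)
  also have "(of_real a ^ 2 * D q - C r) * (D q * ((r^2 + of_real a ^ 2)^2 - of_real a ^ 2 * C r * D q))
      - (r^2 + of_real a ^ 2 - C r)^2 * of_real a ^ 2 * D q ^ 2
      = - C r * D q * (r^2 + of_real a ^ 2 - of_real a ^ 2 * D q)^2"
    by algebra
  also have "r^2 + of_real a ^ 2 - of_real a ^ 2 * D q = z r q * w r q" unfolding zw by (simp add: D_def algebra_simps)
  finally show ?thesis using nz by (simp add: field_simps eval_nat_numeral)
qed

lemma reg_nz: "reg r q \<Longrightarrow> hdet r q \<noteq> 0 \<and> e2 r q \<noteq> 0 \<and> e3 r q \<noteq> 0"
  by (auto simp: hdet_eq reg_def e2_def e3_def)

lemma ginv_eq:
  assumes "y \<in> U"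
  shows "ginv M a y i j = kinv i j (of_real (y$2)) (of_real (y$3))"
proof -
  define r q :: complex where rq: "r = of_real (y$2)" "q = of_real (y$3)"
  have nz: "hdet r q \<noteq> 0" "e2 r q \<noteq> 0" "e3 r q \<noteq> 0"
    using reg_nz[OF U_reg[OF assms]] by (auto simp: rq)
  have d: "(h11 r q * h44 r q - h14 r q * h14 r q) / hdet r q = 1" using nz by (simp add: hdet_def)
  have "matrix_inv (\<chi> i j. kg i j r q) = (\<chi> i j. kinv i j r q)"
    using nz d
    by (intro matrix_inv_eqI)
       (auto simp: vec_eq_iff matrix_matrix_mult_def mat_def forall_4 sum_4 kg_def kinv_def diff_divide_distrib algebra_simps)
  then show ?thesis unfolding ginv_def gmet_eq[OF assms] rq[symmetric] by simp
qed

subsection \<open>Christoffel symbols\<close>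

definition dr :: "(complex \<Rightarrow> complex \<Rightarrow> complex) \<Rightarrow> complex \<Rightarrow> complex \<Rightarrow> complex" where
  "dr f r q = deriv (\<lambda>r. f r q) r"
definition dq :: "(complex \<Rightarrow> complex \<Rightarrow> complex) \<Rightarrow> complex \<Rightarrow> complex \<Rightarrow> complex" where
  "dq f r q = deriv (\<lambda>q. f r q) q"

definition dk :: "4 \<Rightarrow> (complex \<Rightarrow> complex \<Rightarrow> complex) \<Rightarrow> complex \<Rightarrow> complex \<Rightarrow> complex" where
  "dk i f = (if i = 2 then dr f else if i = 3 then dq f else (\<lambda>_ _. 0))"

text \<open>Separate holomorphy suffices: the inverse metric has no (r, q) entry, so that Ricci
  component never enters, and the remaining ones contain only pure second derivatives.\<close>

definition rq_hol :: "(complex \<Rightarrow> complex \<Rightarrow> complex) \<Rightarrow> bool" where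
  "rq_hol f \<longleftrightarrow> (\<forall>q. (\<lambda>r. f r q) holomorphic_on {r. reg r q}) \<and> (\<forall>r. f r holomorphic_on {q. reg r q})"

lemma open_reg: "open {r. reg r q}" "open {q. reg r q}"
  unfolding reg_def z_def w_def C_def D_def
  by (intro open_Collect_conj open_Collect_neq open_Collect_const continuous_intros)+

lemma der_r: "rq_hol f \<Longrightarrow> reg r q \<Longrightarrow> ((\<lambda>r. f r q) has_field_derivative dr f r q) (at r)"
  unfolding dr_def rq_hol_def by (rule holomorphic_derivI[OF _ open_reg(1)]) auto

lemma der_q: "rq_hol f \<Longrightarrow> reg r q \<Longrightarrow> ((\<lambda>q. f r q) has_field_derivative dq f r q) (at q)"
  unfolding dq_def rq_hol_def by (rule holomorphic_derivI[OF _ open_reg(2)]) auto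

lemma der_rr: "rq_hol f \<Longrightarrow> reg r q \<Longrightarrow> ((\<lambda>r. dr f r q) has_field_derivative dr (dr f) r q) (at r)"
  unfolding dr_def rq_hol_def
  by (rule holomorphic_derivI[OF _ open_reg(1)]) (auto intro: holomorphic_deriv open_reg)

lemma der_qq: "rq_hol f \<Longrightarrow> reg r q \<Longrightarrow> ((\<lambda>q. dq f r q) has_field_derivative dq (dq f) r q) (at q)"
  unfolding dq_def rq_hol_def
  by (rule holomorphic_derivI[OF _ open_reg(2)]) (auto intro: holomorphic_deriv open_reg)

lemma rq_hol_kg:
  shows hol_h11: "rq_hol h11" and hol_h14: "rq_hol h14" and hol_h44: "rq_hol h44"
    and hol_e2: "rq_hol e2" and hol_e3: "rq_hol e3"
  unfolding rq_hol_def h11_def h14_def h44_def e2_def e3_def z_def w_def C_def D_def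
  by (auto intro!: holomorphic_intros simp: reg_def z_def w_def C_def D_def)

lemma hol_kg: "rq_hol (kg i j)"
proof -
  have "rq_hol (\<lambda>_ _. 0)" by (simp add: rq_hol_def)
  then show ?thesis using rq_hol_kg by (simp add: kg_def)
qed

lemma has_pd_dk:
  assumes "rq_hol f" "x \<in> U"
  shows "has_pd i (\<lambda>y. f (of_real (y$2)) (of_real (y$3))) (dk i f (of_real (x$2)) (of_real (x$3))) x"
  using exhaust_4[of i] has_pd_rq_1[of f] has_pd_rq_4[of f]
    has_pd_rq_2[of f, OF der_r[OF assms(1) U_reg[OF assms(2)]]]
    has_pd_rq_3[of f, OF der_q[OF assms(1) U_reg[OF assms(2)]]]
  by (elim disjE) (simp_all add: dk_def)

lemma pd_gmet:
  assumes "x \<in> U"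
  shows "pd i (\<lambda>y. gmet M a y j l) x = dk i (kg j l) (of_real (x$2)) (of_real (x$3))"
proof -
  have "pd i (\<lambda>y. gmet M a y j l) x = pd i (\<lambda>y. kg j l (of_real (y$2)) (of_real (y$3))) x"
    by (rule pd_cong_open[OF open_U assms gmet_eq])
  also have "\<dots> = dk i (kg j l) (of_real (x$2)) (of_real (x$3))"
    by (rule has_pd_imp_pd[OF has_pd_dk[where f = "kg j l", OF hol_kg assms]])
  finally show ?thesis .
qed

lemma kg_table:
  "kg 1 1 = h11"
  "kg 1 2 = (\<lambda>_ _. 0)"
  "kg 1 3 = (\<lambda>_ _. 0)"
  "kg 1 4 = h14"
  "kg 2 1 = (\<lambda>_ _. 0)"
  "kg 2 2 = e2"
  "kg 2 3 = (\<lambda>_ _. 0)"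
  "kg 2 4 = (\<lambda>_ _. 0)"
  "kg 3 1 = (\<lambda>_ _. 0)"
  "kg 3 2 = (\<lambda>_ _. 0)"
  "kg 3 3 = e3"
  "kg 3 4 = (\<lambda>_ _. 0)"
  "kg 4 1 = h14"
  "kg 4 2 = (\<lambda>_ _. 0)"
  "kg 4 3 = (\<lambda>_ _. 0)"
  "kg 4 4 = h44"
  by (simp_all add: kg_def)

lemma kinv_table:
  "kinv 1 1 r q = h44 r q / hdet r q"
  "kinv 1 2 r q = 0"
  "kinv 1 3 r q = 0"
  "kinv 1 4 r q = - h14 r q / hdet r q"
  "kinv 2 1 r q = 0"
  "kinv 2 2 r q = 1 / e2 r q"
  "kinv 2 3 r q = 0"
  "kinv 2 4 r q = 0"
  "kinv 3 1 r q = 0"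
  "kinv 3 2 r q = 0"
  "kinv 3 3 r q = 1 / e3 r q"
  "kinv 3 4 r q = 0"
  "kinv 4 1 r q = - h14 r q / hdet r q"
  "kinv 4 2 r q = 0"
  "kinv 4 3 r q = 0"
  "kinv 4 4 r q = h11 r q / hdet r q"
  by (simp_all add: kinv_def)

lemma dk_table:
  "dk 1 f = (\<lambda>_ _. 0)" "dk 2 f = dr f" "dk 3 f = dq f" "dk 4 f = (\<lambda>_ _. 0)"
  by (simp_all add: dk_def)

lemma dr_dq_zero: "dr (\<lambda>_ _. 0) = (\<lambda>_ _. 0)" "dq (\<lambda>_ _. 0) = (\<lambda>_ _. 0)"
  by (simp_all add: dr_def dq_def fun_eq_iff)

lemma kg_sym: "kg i j = kg j i"
  using exhaust_4[of i] exhaust_4[of j] by (elim disjE; simp add: kg_table)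

definition kGam :: "4 \<Rightarrow> 4 \<Rightarrow> 4 \<Rightarrow> complex \<Rightarrow> complex \<Rightarrow> complex" where
  "kGam c i j r q = (1/2) * (\<Sum>d\<in>UNIV. kinv c d r q *
     (dk i (kg d j) r q + dk j (kg d i) r q - dk d (kg i j) r q))"

lemma Gam_eq: "y \<in> U \<Longrightarrow> Gam M a y c i j = kGam c i j (of_real (y$2)) (of_real (y$3))"
  by (simp add: Gam_def kGam_def ginv_eq pd_gmet)

lemma kGam_sym: "kGam c i j r q = kGam c j i r q"
  by (simp add: kGam_def kg_sym[of i j] algebra_simps)

abbreviation tphi :: "4 \<Rightarrow> bool" where "tphi i \<equiv> i = 1 \<or> i = 4"

text \<open>The hypothesis says that an odd number of the three indices lies in {t, phi}. Such
  symbols vanish because the metric is invariant under (t, phi) -> (-t, -phi): every summand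
  contains an off-block entry or a derivative in t or phi.\<close>

lemma kGam_zero:
  assumes "tphi c \<longleftrightarrow> (tphi i \<longleftrightarrow> tphi j)"
  shows "kGam c i j r q = 0"
proof -
  have inv0: "kinv c d r q = 0" if "tphi c \<noteq> tphi d" for c d
    using that unfolding kinv_def by (simp split del: if_split) auto
  have kg0: "dk i (kg d j) r q = 0" if "tphi d \<noteq> tphi j" for i d j
  proof -
    have "kg d j = (\<lambda>_ _. 0)" using that unfolding kg_def by auto
    then show ?thesis by (simp add: dk_def dr_dq_zero)
  qed
  have dk0: "dk i f r q = 0" if "tphi i" for i f
    using that by (auto simp: dk_table)
  have term0: "kinv c d r q * (dk i (kg d j) r q + dk j (kg d i) r q - dk d (kg i j) r q) = 0" for d
  proof (cases "tphi c = tphi d")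
    case True
    then have "dk i (kg d j) r q = 0" "dk j (kg d i) r q = 0" "dk d (kg i j) r q = 0"
      using assms kg0 dk0 by blast+
    then show ?thesis by simp
  qed (simp add: inv0)
  show ?thesis by (simp only: kGam_def term0 sum.neutral_const mult_zero_right)
qed

text \<open>Reciprocals are kept as \<open>inverse\<close> atoms, so that the curvature identities
  become polynomial in them.\<close>

lemma kGam_table:
  "kGam 1 1 2 r q = (h44 r q * dr h11 r q - h14 r q * dr h14 r q) * inverse (hdet r q) / 2"
  "kGam 1 4 2 r q = (h44 r q * dr h14 r q - h14 r q * dr h44 r q) * inverse (hdet r q) / 2"
  "kGam 4 1 2 r q = (h11 r q * dr h14 r q - h14 r q * dr h11 r q) * inverse (hdet r q) / 2"
  "kGam 4 4 2 r q = (h11 r q * dr h44 r q - h14 r q * dr h14 r q) * inverse (hdet r q) / 2"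
  "kGam 1 1 3 r q = (h44 r q * dq h11 r q - h14 r q * dq h14 r q) * inverse (hdet r q) / 2"
  "kGam 1 4 3 r q = (h44 r q * dq h14 r q - h14 r q * dq h44 r q) * inverse (hdet r q) / 2"
  "kGam 4 1 3 r q = (h11 r q * dq h14 r q - h14 r q * dq h11 r q) * inverse (hdet r q) / 2"
  "kGam 4 4 3 r q = (h11 r q * dq h44 r q - h14 r q * dq h14 r q) * inverse (hdet r q) / 2"
  "kGam 2 1 1 r q = - dr h11 r q * inverse (e2 r q) / 2"
  "kGam 2 1 4 r q = - dr h14 r q * inverse (e2 r q) / 2"
  "kGam 2 4 4 r q = - dr h44 r q * inverse (e2 r q) / 2"
  "kGam 3 1 1 r q = - dq h11 r q * inverse (e3 r q) / 2"
  "kGam 3 1 4 r q = - dq h14 r q * inverse (e3 r q) / 2"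
  "kGam 3 4 4 r q = - dq h44 r q * inverse (e3 r q) / 2"
  "kGam 2 2 2 r q = dr e2 r q * inverse (e2 r q) / 2"
  "kGam 2 2 3 r q = dq e2 r q * inverse (e2 r q) / 2"
  "kGam 2 3 3 r q = - dr e3 r q * inverse (e2 r q) / 2"
  "kGam 3 2 2 r q = - dq e2 r q * inverse (e3 r q) / 2"
  "kGam 3 2 3 r q = dr e3 r q * inverse (e3 r q) / 2"
  "kGam 3 3 3 r q = dq e3 r q * inverse (e3 r q) / 2"
  by (simp_all add: kGam_def sum_4 kinv_table kg_table dk_table dr_dq_zero, simp_all add: divide_inverse algebra_simps)

lemmas kGam_sym_table =
  kGam_sym[of _ 2 1] kGam_sym[of _ 2 4] kGam_sym[of _ 3 1] kGam_sym[of _ 3 4] kGam_sym[of _ 4 1] kGam_sym[of _ 3 2]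

lemma pd_Gam_zero: "x \<in> U \<Longrightarrow> tphi m \<Longrightarrow> pd m (\<lambda>y. Gam M a y c i j) x = 0"
  using pd_cong_open[OF open_U, of x "\<lambda>y. Gam M a y c i j" "\<lambda>y. kGam c i j (of_real (y$2)) (of_real (y$3))"]
    Gam_eq has_pd_imp_pd[OF has_pd_rq_1] has_pd_imp_pd[OF has_pd_rq_4] by auto

lemma pd_Gam_2:
  assumes "x \<in> U" "((\<lambda>r. kGam c i j r (of_real (x$3))) has_field_derivative d) (at (of_real (x$2)))"
  shows "pd 2 (\<lambda>y. Gam M a y c i j) x = d"
  using pd_cong_open[OF open_U assms(1), of "\<lambda>y. Gam M a y c i j" "\<lambda>y. kGam c i j (of_real (y$2)) (of_real (y$3))"]
    Gam_eq has_pd_imp_pd[OF has_pd_rq_2[where f = "kGam c i j", OF assms(2)]] by auto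

lemma pd_Gam_3:
  assumes "x \<in> U" "((\<lambda>q. kGam c i j (of_real (x$2)) q) has_field_derivative d) (at (of_real (x$3)))"
  shows "pd 3 (\<lambda>y. Gam M a y c i j) x = d"
  using pd_cong_open[OF open_U assms(1), of "\<lambda>y. Gam M a y c i j" "\<lambda>y. kGam c i j (of_real (y$2)) (of_real (y$3))"]
    Gam_eq has_pd_imp_pd[OF has_pd_rq_3[where f = "kGam c i j", OF assms(2)]] by auto

subsection \<open>Curvature of a block diagonal metric\<close>

lemma Gam_sym: "Gam M a y c i j = Gam M a y c j i"
proof -
  have "gmet M a y i j = gmet M a y j i" for y by (simp add: gmet_def gKerr_def algebra_simps)
  then have "(\<lambda>y. gmet M a y i j) = (\<lambda>y. gmet M a y j i)" by simp
  then show ?thesis by (simp add: Gam_def add.commute)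
qed

lemmas Gam_sym_table =
  Gam_sym[of _ _ 2 1] Gam_sym[of _ _ 2 4] Gam_sym[of _ _ 3 1] Gam_sym[of _ _ 3 4] Gam_sym[of _ _ 4 1] Gam_sym[of _ _ 3 2]

text \<open>Jacobi's formula: these are the derivatives of \<open>hdet\<close> expressed by first
  derivatives of the entries, so that dividing by \<open>hdet\<close> gives the trace of h^(-1)
  h'.\<close>

abbreviation "ddr \<equiv> \<lambda>r q. h44 r q * dr h11 r q + h11 r q * dr h44 r q - 2 * h14 r q * dr h14 r q"
abbreviation "ddq \<equiv> \<lambda>r q. h44 r q * dq h11 r q + h11 r q * dq h44 r q - 2 * h14 r q * dq h14 r q"

lemma hdet_der:
  assumes "reg r q"
  shows "((\<lambda>r. hdet r q) has_field_derivative ddr r q) (at r)" "((\<lambda>q. hdet r q) has_field_derivative ddq r q) (at q)"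
  unfolding hdet_def
  by (rule derivative_eq_intros der_r der_q rq_hol_kg assms refl | simp add: algebra_simps)+

lemma inv_der:
  assumes "reg r q"
  shows "((\<lambda>r. inverse (hdet r q)) has_field_derivative - ddr r q * inverse (hdet r q)^2) (at r)"
    "((\<lambda>q. inverse (hdet r q)) has_field_derivative - ddq r q * inverse (hdet r q)^2) (at q)"
    "((\<lambda>r. inverse (e2 r q)) has_field_derivative - dr e2 r q * inverse (e2 r q)^2) (at r)"
    "((\<lambda>q. inverse (e2 r q)) has_field_derivative - dq e2 r q * inverse (e2 r q)^2) (at q)"
    "((\<lambda>r. inverse (e3 r q)) has_field_derivative - dr e3 r q * inverse (e3 r q)^2) (at r)"
    "((\<lambda>q. inverse (e3 r q)) has_field_derivative - dq e3 r q * inverse (e3 r q)^2) (at q)"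
  using reg_nz[OF assms] der_r[OF hol_e2 assms] der_q[OF hol_e2 assms] der_r[OF hol_e3 assms] der_q[OF hol_e3 assms]
    hdet_der[OF assms]
  by (auto intro!: DERIV_cong[OF DERIV_inverse'] simp: power2_eq_square algebra_simps)

lemma kGam_der_r:
  assumes "reg r q"
  shows "((\<lambda>r. kGam 2 1 1 r q) has_field_derivative
      (dr h11 r q * dr e2 r q * inverse (e2 r q)^2 - dr (dr h11) r q * inverse (e2 r q)) / 2) (at r)"
    "((\<lambda>r. kGam 2 1 4 r q) has_field_derivative
      (dr h14 r q * dr e2 r q * inverse (e2 r q)^2 - dr (dr h14) r q * inverse (e2 r q)) / 2) (at r)"
    "((\<lambda>r. kGam 2 4 4 r q) has_field_derivative
      (dr h44 r q * dr e2 r q * inverse (e2 r q)^2 - dr (dr h44) r q * inverse (e2 r q)) / 2) (at r)"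
    "((\<lambda>r. kGam 2 3 3 r q) has_field_derivative
      (dr e3 r q * dr e2 r q * inverse (e2 r q)^2 - dr (dr e3) r q * inverse (e2 r q)) / 2) (at r)"
    "((\<lambda>r. kGam 3 2 3 r q) has_field_derivative
      (dr (dr e3) r q * inverse (e3 r q) - dr e3 r q ^2 * inverse (e3 r q)^2) / 2) (at r)"
    "((\<lambda>r. kGam 1 1 2 r q) has_field_derivative
      ((dr h44 r q * dr h11 r q + h44 r q * dr (dr h11) r q - dr h14 r q ^2 - h14 r q * dr (dr h14) r q) * inverse (hdet r q)
       - (h44 r q * dr h11 r q - h14 r q * dr h14 r q) * ddr r q * inverse (hdet r q)^2) / 2) (at r)"
    "((\<lambda>r. kGam 4 4 2 r q) has_field_derivative
      ((dr h11 r q * dr h44 r q + h11 r q * dr (dr h44) r q - dr h14 r q ^2 - h14 r q * dr (dr h14) r q) * inverse (hdet r q)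
       - (h11 r q * dr h44 r q - h14 r q * dr h14 r q) * ddr r q * inverse (hdet r q)^2) / 2) (at r)"
  unfolding kGam_table
  by (rule derivative_eq_intros inv_der der_r der_rr rq_hol_kg assms refl
      | simp add: power2_eq_square algebra_simps add_divide_distrib diff_divide_distrib)+

lemma kGam_der_q:
  assumes "reg r q"
  shows "((\<lambda>q. kGam 3 1 1 r q) has_field_derivative
      (dq h11 r q * dq e3 r q * inverse (e3 r q)^2 - dq (dq h11) r q * inverse (e3 r q)) / 2) (at q)"
    "((\<lambda>q. kGam 3 1 4 r q) has_field_derivative
      (dq h14 r q * dq e3 r q * inverse (e3 r q)^2 - dq (dq h14) r q * inverse (e3 r q)) / 2) (at q)"
    "((\<lambda>q. kGam 3 4 4 r q) has_field_derivative
      (dq h44 r q * dq e3 r q * inverse (e3 r q)^2 - dq (dq h44) r q * inverse (e3 r q)) / 2) (at q)"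
    "((\<lambda>q. kGam 3 2 2 r q) has_field_derivative
      (dq e2 r q * dq e3 r q * inverse (e3 r q)^2 - dq (dq e2) r q * inverse (e3 r q)) / 2) (at q)"
    "((\<lambda>q. kGam 2 2 3 r q) has_field_derivative
      (dq (dq e2) r q * inverse (e2 r q) - dq e2 r q ^2 * inverse (e2 r q)^2) / 2) (at q)"
    "((\<lambda>q. kGam 1 1 3 r q) has_field_derivative
      ((dq h44 r q * dq h11 r q + h44 r q * dq (dq h11) r q - dq h14 r q ^2 - h14 r q * dq (dq h14) r q) * inverse (hdet r q)
       - (h44 r q * dq h11 r q - h14 r q * dq h14 r q) * ddq r q * inverse (hdet r q)^2) / 2) (at q)"
    "((\<lambda>q. kGam 4 4 3 r q) has_field_derivative
      ((dq h11 r q * dq h44 r q + h11 r q * dq (dq h44) r q - dq h14 r q ^2 - h14 r q * dq (dq h14) r q) * inverse (hdet r q)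
       - (h11 r q * dq h44 r q - h14 r q * dq h14 r q) * ddq r q * inverse (hdet r q)^2) / 2) (at q)"
  unfolding kGam_table
  by (rule derivative_eq_intros inv_der der_q der_qq rq_hol_kg assms refl
      | simp add: power2_eq_square algebra_simps add_divide_distrib diff_divide_distrib)+

text \<open>After the parity rule and independence of t and phi, the four-term sums in front are the
  traces Gamma^l_{l2} and Gamma^l_{l3}, the logarithmic derivatives of the volume density.\<close>

lemma Ric_tphi:
  assumes "x \<in> U" "tphi s" "tphi n"
  shows "Ric M a x s n =
    (let k = (\<lambda>c i j. kGam c i j (of_real (x$2)) (of_real (x$3))) in
      pd 2 (\<lambda>y. Gam M a y 2 n s) x + pd 3 (\<lambda>y. Gam M a y 3 n s) x
      + (k 1 1 2 + k 4 4 2 + k 2 2 2 + k 3 2 3) * k 2 n s + (k 1 1 3 + k 4 4 3 + k 2 2 3 + k 3 3 3) * k 3 n s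
      - (k 2 n 1 * k 1 s 2 + k 1 n 2 * k 2 1 s) - (k 2 n 4 * k 4 s 2 + k 4 n 2 * k 2 s 4)
      - (k 3 n 1 * k 1 s 3 + k 1 n 3 * k 3 1 s) - (k 3 n 4 * k 4 s 3 + k 4 n 3 * k 3 s 4))"
  using assms(2,3)
  by (elim disjE; simp add: Ric_def Riem_def sum_4 Let_def pd_Gam_zero assms(1) Gam_eq[OF assms(1)] kGam_zero
       kGam_sym_table algebra_simps)

text \<open>The derivatives of Gamma^2_{22} cancel between the two terms of the Riemann tensor; the
  derivatives that remain are pure second derivatives of metric entries plus first-order
  terms.\<close>

lemma Ric_22:
  assumes "x \<in> U"
  shows "Ric M a x 2 2 =
    (let k = (\<lambda>c i j. kGam c i j (of_real (x$2)) (of_real (x$3))) in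
      pd 3 (\<lambda>y. Gam M a y 3 2 2) x - pd 2 (\<lambda>y. Gam M a y 1 1 2) x - pd 2 (\<lambda>y. Gam M a y 4 4 2) x
      - pd 2 (\<lambda>y. Gam M a y 3 2 3) x
      + (k 1 1 2 + k 4 4 2 + k 2 2 2 + k 3 2 3) * k 2 2 2 + (k 1 1 3 + k 4 4 3 + k 2 2 3 + k 3 3 3) * k 3 2 2
      - (k 1 1 2 ^ 2 + 2 * k 1 4 2 * k 4 1 2 + k 4 4 2 ^ 2 + k 2 2 2 ^ 2 + 2 * k 2 2 3 * k 3 2 2 + k 3 2 3 ^ 2))"
  by (simp add: Ric_def Riem_def sum_4 Let_def pd_Gam_zero assms(1) Gam_eq[OF assms(1)] kGam_zero
       Gam_sym_table kGam_sym_table algebra_simps power2_eq_square)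

lemma Ric_33:
  assumes "x \<in> U"
  shows "Ric M a x 3 3 =
    (let k = (\<lambda>c i j. kGam c i j (of_real (x$2)) (of_real (x$3))) in
      pd 2 (\<lambda>y. Gam M a y 2 3 3) x - pd 3 (\<lambda>y. Gam M a y 1 1 3) x - pd 3 (\<lambda>y. Gam M a y 4 4 3) x
      - pd 3 (\<lambda>y. Gam M a y 2 2 3) x
      + (k 1 1 2 + k 4 4 2 + k 2 2 2 + k 3 2 3) * k 2 3 3 + (k 1 1 3 + k 4 4 3 + k 2 2 3 + k 3 3 3) * k 3 3 3
      - (k 1 1 3 ^ 2 + 2 * k 1 4 3 * k 4 1 3 + k 4 4 3 ^ 2 + k 2 2 3 ^ 2 + 2 * k 2 3 3 * k 3 2 3 + k 3 3 3 ^ 2))"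
  by (simp add: Ric_def Riem_def sum_4 Let_def pd_Gam_zero assms(1) Gam_eq[OF assms(1)] kGam_zero
       Gam_sym_table kGam_sym_table algebra_simps power2_eq_square)

end

text \<open>The trace of the (t, phi) Ricci block over h, for one of the directions r and q: K is
  h^(-1) h'/2, G is the symbol -f h'/2, and h^(-1) G = -f K turns the quadratic terms into 2f tr
  K^2. Both directions are instances.\<close>

lemma block_trace_identity:
  fixes f u \<sigma> e h11 h14 h44 h11' h14' h44' h11'' h14'' h44'' :: complex
  defines "K11 \<equiv> (h44 * h11' - h14 * h14') * u / 2" and "K14 \<equiv> (h44 * h14' - h14 * h44') * u / 2"
    and "K41 \<equiv> (h11 * h14' - h14 * h11') * u / 2" and "K44 \<equiv> (h11 * h44' - h14 * h14') * u / 2"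
    and "G11 \<equiv> - h11' * f / 2" and "G14 \<equiv> - h14' * f / 2" and "G44 \<equiv> - h44' * f / 2"
    and "D \<equiv> h44 * h11' + h11 * h44' - 2 * h14 * h14'"
  shows
    "u * h44 * ((h11' * e * f^2 - h11'' * f) / 2 + \<sigma> * G11 - (G11 * K11 + K11 * G11) - (G14 * K41 + K41 * G14))
     - u * h14 * ((h14' * e * f^2 - h14'' * f) / 2 + \<sigma> * G14 - (G14 * K11 + K14 * G11) - (G44 * K41 + K44 * G14))
     - u * h14 * ((h14' * e * f^2 - h14'' * f) / 2 + \<sigma> * G14 - (G11 * K14 + K11 * G14) - (G14 * K44 + K41 * G44))
     + u * h11 * ((h44' * e * f^2 - h44'' * f) / 2 + \<sigma> * G44 - (G14 * K14 + K14 * G14) - (G44 * K44 + K44 * G44))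
     = - f * u * (h44 * h11'' + h11 * h44'' - 2 * h14 * h14'') / 2 + f^2 * e * u * D / 2 - f * u * D * \<sigma> / 2
       + 2 * f * (K11^2 + 2 * K14 * K41 + K44^2)"
  unfolding assms by (simp add: field_simps power2_eq_square)

text \<open>Cayley--Hamilton for \<open>K = h\<^sup>-\<^sup>1 h'/2\<close>: \<open>tr K\<^sup>2 = (tr K)\<^sup>2 - 2 det K\<close>.\<close>

lemma trace_square_eq:
  fixes u h11 h14 h44 h11' h14' h44' :: complex
  assumes "u * (h11 * h44 - h14 * h14) = 1"
  shows "((h44 * h11' - h14 * h14') * u / 2)^2
      + 2 * ((h44 * h14' - h14 * h44') * u / 2) * ((h11 * h14' - h14 * h11') * u / 2)
      + ((h11 * h44' - h14 * h14') * u / 2)^2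
     = ((h44 * h11' + h11 * h44' - 2 * h14 * h14') * u)^2 / 4 - (h11' * h44' - h14'^2) * u / 2"
proof -
  have "((h44 * h11' - h14 * h14') * u / 2)^2
      + 2 * ((h44 * h14' - h14 * h44') * u / 2) * ((h11 * h14' - h14 * h11') * u / 2)
      + ((h11 * h44' - h14 * h14') * u / 2)^2
    = ((h44 * h11' + h11 * h44' - 2 * h14 * h14') * u)^2 / 4
      - (u * (h11 * h44 - h14 * h14)) * (h11' * h44' - h14'^2) * u / 2"
    by (simp add: field_simps power2_eq_square)
  then show ?thesis unfolding assms by simp
qed

context kerr begin

text \<open>The \<open>f * g\<close> bracket is the scalar curvature of the surface metric e2 dr^2 +
  e3 dq^2. In the other two brackets the coefficient -3/2 of det h' is -1 from the (t, phi) trace,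
  -1 from differentiating tr K, and +1/2 from the tr K^2 in \<open>Ric_22\<close> or
  \<open>Ric_33\<close>.\<close>

lemma scal_block:
  assumes x: "x \<in> U" and rq: "r = of_real (x$2)" "q = of_real (x$3)"
    and f: "f = inverse (e2 r q)" and g: "g = inverse (e3 r q)" and u: "u = inverse (hdet r q)"
  shows "scal M a x =
    f * g * (- (dq (dq e2) r q + dr (dr e3) r q)
      + (dq e2 r q ^2 * f + dq e2 r q * dq e3 r q * g + dr e3 r q ^2 * g + dr e3 r q * dr e2 r q * f) / 2)
    + f * (- (h44 r q * dr (dr h11) r q + h11 r q * dr (dr h44) r q - 2 * h14 r q * dr (dr h14) r q) * u
        - 3/2 * (dr h11 r q * dr h44 r q - dr h14 r q ^2) * u + (ddr r q)^2 * u^2 / 2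
        + ddr r q * u / 2 * (dr e2 r q * f - dr e3 r q * g))
    + g * (- (h44 r q * dq (dq h11) r q + h11 r q * dq (dq h44) r q - 2 * h14 r q * dq (dq h14) r q) * u
        - 3/2 * (dq h11 r q * dq h44 r q - dq h14 r q ^2) * u + (ddq r q)^2 * u^2 / 2
        + ddq r q * u / 2 * (dq e3 r q * g - dq e2 r q * f))"
proof -
  have rg: "reg r q" using U_reg[OF x] by (simp add: rq)
  have ud: "u * (h11 r q * h44 r q - h14 r q * h14 r q) = 1"
    using reg_nz[OF rg] by (simp add: u hdet_def)
  have P2: "pd 2 (\<lambda>y. Gam M a y c i j) x = d"
    if "((\<lambda>r. kGam c i j r q) has_field_derivative d) (at r)" for c i j d
    using pd_Gam_2[OF x] that by (simp add: rq)
  have P3: "pd 3 (\<lambda>y. Gam M a y c i j) x = d"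
    if "((\<lambda>q. kGam c i j r q) has_field_derivative d) (at q)" for c i j d
    using pd_Gam_3[OF x] that by (simp add: rq)
  note PG = kGam_der_r[OF rg, THEN P2] kGam_der_q[OF rg, THEN P3]
  \<comment> \<open>Logarithmic derivatives of the square root of hdet * e2 * e3.\<close>
  define \<sigma>2 where "\<sigma>2 = ddr r q * u / 2 + dr e2 r q * f / 2 + dr e3 r q * g / 2"
  define \<sigma>3 where "\<sigma>3 = ddq r q * u / 2 + dq e2 r q * f / 2 + dq e3 r q * g / 2"
  let ?k = "\<lambda>c i j. kGam c i j r q"
  have s2: "?k 1 1 2 + ?k 4 4 2 + ?k 2 2 2 + ?k 3 2 3 = \<sigma>2"
    and s3: "?k 1 1 3 + ?k 4 4 3 + ?k 2 2 3 + ?k 3 3 3 = \<sigma>3"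
    unfolding \<sigma>2_def \<sigma>3_def kGam_table f g u
    by (simp_all add: algebra_simps add_divide_distrib diff_divide_distrib)
  note ric = Ric_tphi[OF x, folded rq, unfolded Let_def s2 s3]
    Ric_22[OF x, folded rq, unfolded Let_def s2 s3] Ric_33[OF x, folded rq, unfolded Let_def s2 s3]
  note fold = f[symmetric] g[symmetric] u[symmetric]
  have "scal M a x = u * h44 r q * Ric M a x 1 1 - u * h14 r q * Ric M a x 1 4 - u * h14 r q * Ric M a x 4 1
      + u * h11 r q * Ric M a x 4 4 + f * Ric M a x 2 2 + g * Ric M a x 3 3"
    unfolding scal_def sum_4 ginv_eq[OF x] rq[symmetric] kinv_table f g u
    by (simp add: divide_inverse algebra_simps)
  also have "u * h44 r q * Ric M a x 1 1 - u * h14 r q * Ric M a x 1 4 - u * h14 r q * Ric M a x 4 1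
      + u * h11 r q * Ric M a x 4 4
    = (- f * u * (h44 r q * dr (dr h11) r q + h11 r q * dr (dr h44) r q - 2 * h14 r q * dr (dr h14) r q) / 2
        + f^2 * dr e2 r q * u * ddr r q / 2 - f * u * ddr r q * \<sigma>2 / 2
        + 2 * f * (?k 1 1 2 ^ 2 + 2 * ?k 1 4 2 * ?k 4 1 2 + ?k 4 4 2 ^ 2))
    + (- g * u * (h44 r q * dq (dq h11) r q + h11 r q * dq (dq h44) r q - 2 * h14 r q * dq (dq h14) r q) / 2
        + g^2 * dq e3 r q * u * ddq r q / 2 - g * u * ddq r q * \<sigma>3 / 2
        + 2 * g * (?k 1 1 3 ^ 2 + 2 * ?k 1 4 3 * ?k 4 1 3 + ?k 4 4 3 ^ 2))"
    unfolding kGam_table fold block_trace_identity[symmetric]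
    by (simp add: ric PG kGam_sym_table kGam_sym[of _ 4 1] Gam_sym[of _ _ 4 1])
       (simp add: kGam_table fold algebra_simps add_divide_distrib diff_divide_distrib)
  also have T2: "?k 1 1 2 ^ 2 + 2 * ?k 1 4 2 * ?k 4 1 2 + ?k 4 4 2 ^ 2
      = (ddr r q * u)^2 / 4 - (dr h11 r q * dr h44 r q - dr h14 r q ^2) * u / 2"
    unfolding kGam_table fold by (rule trace_square_eq[OF ud])
  also have T3: "?k 1 1 3 ^ 2 + 2 * ?k 1 4 3 * ?k 4 1 3 + ?k 4 4 3 ^ 2
      = (ddq r q * u)^2 / 4 - (dq h11 r q * dq h44 r q - dq h14 r q ^2) * u / 2"
    unfolding kGam_table fold by (rule trace_square_eq[OF ud])
  \<comment> \<open>The derivative of tr K = \<open>ddr r q * u / 2\<close> produces the entries'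
    second derivatives together with 2 det h', the combination that is (det h)''.\<close>
  also have "Ric M a x 2 2 = (dq e2 r q * dq e3 r q * g^2 - dq (dq e2) r q * g) / 2
      - (u * (h44 r q * dr (dr h11) r q + h11 r q * dr (dr h44) r q - 2 * h14 r q * dr (dr h14) r q
          + 2 * (dr h11 r q * dr h44 r q - dr h14 r q ^2)) - (ddr r q)^2 * u^2) / 2
      - (dr (dr e3) r q * g - (dr e3 r q)^2 * g^2) / 2
      + \<sigma>2 * (dr e2 r q * f / 2) - \<sigma>3 * (dq e2 r q * g / 2)
      - ((ddr r q * u)^2 / 4 - (dr h11 r q * dr h44 r q - dr h14 r q ^2) * u / 2
         + (dr e2 r q * f)^2 / 4 - (dq e2 r q)^2 * f * g / 2 + (dr e3 r q * g)^2 / 4)"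
    unfolding ric PG T2[symmetric] fold
    unfolding kGam_table(15-) fold by (simp add: field_simps power2_eq_square)
  also have "Ric M a x 3 3 = (dr e3 r q * dr e2 r q * f^2 - dr (dr e3) r q * f) / 2
      - (u * (h44 r q * dq (dq h11) r q + h11 r q * dq (dq h44) r q - 2 * h14 r q * dq (dq h14) r q
          + 2 * (dq h11 r q * dq h44 r q - dq h14 r q ^2)) - (ddq r q)^2 * u^2) / 2
      - (dq (dq e2) r q * f - (dq e2 r q)^2 * f^2) / 2
      + \<sigma>3 * (dq e3 r q * g / 2) - \<sigma>2 * (dr e3 r q * f / 2)
      - ((ddq r q * u)^2 / 4 - (dq h11 r q * dq h44 r q - dq h14 r q ^2) * u / 2
         + (dq e3 r q * g)^2 / 4 - (dr e3 r q)^2 * f * g / 2 + (dq e2 r q * f)^2 / 4)"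
    unfolding ric PG T3[symmetric] fold
    unfolding kGam_table(15-) fold by (simp add: field_simps power2_eq_square)
  finally show ?thesis unfolding \<sigma>2_def \<sigma>3_def by (rule trans) (simp add: field_simps power2_eq_square)
qed

subsection \<open>Scalar curvature\<close>

abbreviation aa :: complex where "aa \<equiv> of_real a"
abbreviation b :: complex where "b \<equiv> \<i> * of_real a"
abbreviation C' :: "complex \<Rightarrow> complex" where "C' r \<equiv> 2 * r - 2 * of_real M"

lemma elem_der:
  "((\<lambda>r. z r q) has_field_derivative 1) (at r)" "((\<lambda>q. z r q) has_field_derivative b) (at q)"
  "((\<lambda>r. w r q) has_field_derivative 1) (at r)" "((\<lambda>q. w r q) has_field_derivative - b) (at q)"
  "((\<lambda>r. C r) has_field_derivative C' r) (at r)" "((\<lambda>q. D q) has_field_derivative - 2 * q) (at q)"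
  unfolding z_def w_def C_def D_def by (auto intro!: derivative_eq_intros)

section \<open>Explicit derivatives of the metric coefficients\<close>

lemma dr_eqI:
  assumes "reg r q" "\<And>r'. reg r' q \<Longrightarrow> f r' q = F r'" "(F has_field_derivative d) (at r)"
  shows "dr f r q = d"
  unfolding dr_def
  by (rule DERIV_imp_deriv, rule has_field_derivative_transform_within_open[OF assms(3) open_reg(1)[of q]])
    (use assms in auto)

lemma dq_eqI:
  assumes "reg r q" "\<And>q'. reg r q' \<Longrightarrow> f r q' = F q'" "(F has_field_derivative d) (at q)"
  shows "dq f r q = d"
  unfolding dq_def
  by (rule DERIV_imp_deriv, rule has_field_derivative_transform_within_open[OF assms(3) open_reg(2)[of r]])
    (use assms in auto)

lemma dr_e2: "reg r q \<Longrightarrow> dr e2 r q = e2 r q * (1 / w r q - 1 / z r q - C' r / C r)"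
  by (rule dr_eqI[OF _ refl]) (auto intro!: derivative_eq_intros elem_der simp: e2_def reg_def field_simps)
lemma dq_e3: "reg r q \<Longrightarrow> dq e3 r q = e3 r q * (- b / w r q - b / z r q + 2 * q / D q)"
  by (rule dq_eqI[OF _ refl]) (auto intro!: derivative_eq_intros elem_der simp: e3_def reg_def field_simps)
text \<open>Here z + w = 2r, and z - w = 2iaq in the next lemma, eliminate w from the derivative of
  w/z; this is the form that is differentiated once more.\<close>

lemma dq_e2: "reg r q \<Longrightarrow> dq e2 r q = - 2 * b * r / (z r q ^2 * C r)"
  by (rule dq_eqI[OF _ refl])
    (auto intro!: derivative_eq_intros elem_der simp: e2_def reg_def field_simps power2_eq_square,
     simp_all add: z_def w_def algebra_simps)
lemma dr_e3: "reg r q \<Longrightarrow> dr e3 r q = 2 * b * q / (z r q ^2 * D q)"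
  by (rule dr_eqI[OF _ refl])
    (auto intro!: derivative_eq_intros elem_der simp: e3_def reg_def field_simps power2_eq_square,
     simp_all add: z_def w_def algebra_simps)
lemma dqq_e2: "reg r q \<Longrightarrow> dq (dq e2) r q = - 4 * aa^2 * r / (z r q ^3 * C r)"
  by (rule dq_eqI[where F = "\<lambda>q. - 2 * b * r / (z r q ^2 * C r)"], assumption, erule dq_e2)
    (auto intro!: derivative_eq_intros elem_der simp: reg_def field_simps power2_eq_square power3_eq_cube)
lemma drr_e3: "reg r q \<Longrightarrow> dr (dr e3) r q = - 4 * b * q / (z r q ^3 * D q)"
  by (rule dr_eqI[where F = "\<lambda>r. 2 * b * q / (z r q ^2 * D q)"], assumption, erule dr_e3)
    (auto intro!: derivative_eq_intros elem_der simp: reg_def field_simps power2_eq_square power3_eq_cube)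

text \<open>The derivative of the determinant computed in two ways: by the product rule from the
  entries, and from the closed form -CD/z^4, whose logarithmic derivative appears in the
  bracket.\<close>

lemma ddr_eq:
  assumes rg: "reg r q"
  shows "ddr r q = hdet r q * (C' r / C r - 4 / z r q)"
proof -
  have nz: "z r q \<noteq> 0" "w r q \<noteq> 0" "C r \<noteq> 0" "D q \<noteq> 0" using rg by (auto simp: reg_def)
  have "((\<lambda>r. - C r * D q / z r q ^ 4) has_field_derivative
      ((- C' r * D q) * z r q ^ 4 - - C r * D q * (4 * z r q ^ 3)) / (z r q ^ 4 * z r q ^ 4)) (at r)"
    by (rule derivative_eq_intros elem_der refl | simp add: nz)+
  moreover have "((- C' r * D q) * z r q ^ 4 - - C r * D q * (4 * z r q ^ 3)) / (z r q ^ 4 * z r q ^ 4)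
      = - C r * D q / z r q ^ 4 * (C' r / C r - 4 / z r q)"
    using nz by (simp add: divide_simps) algebra
  ultimately have "((\<lambda>r. - C r * D q / z r q ^ 4) has_field_derivative hdet r q * (C' r / C r - 4 / z r q)) (at r)"
    unfolding hdet_eq[OF rg] by simp
  then have "dr hdet r q = hdet r q * (C' r / C r - 4 / z r q)"
    by (rule dr_eqI[rotated 2]) (use rg in \<open>auto simp: hdet_eq\<close>)
  moreover have "dr hdet r q = ddr r q"
    unfolding dr_def by (rule DERIV_imp_deriv[OF hdet_der(1)[OF rg, unfolded dr_def]])
  ultimately show ?thesis by simp
qed

lemma ddq_eq:
  assumes rg: "reg r q"
  shows "ddq r q = hdet r q * (- 2 * q / D q - 4 * b / z r q)"
proof -
  have nz: "z r q \<noteq> 0" "w r q \<noteq> 0" "C r \<noteq> 0" "D q \<noteq> 0" using rg by (auto simp: reg_def)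
  have "((\<lambda>q. - C r * D q / z r q ^ 4) has_field_derivative
      ((- C r * (- 2 * q)) * z r q ^ 4 - - C r * D q * (4 * b * z r q ^ 3)) / (z r q ^ 4 * z r q ^ 4)) (at q)"
    by (rule derivative_eq_intros elem_der refl | simp add: nz)+
  moreover have "((- C r * (- 2 * q)) * z r q ^ 4 - - C r * D q * (4 * b * z r q ^ 3)) / (z r q ^ 4 * z r q ^ 4)
      = - C r * D q / z r q ^ 4 * (- 2 * q / D q - 4 * b / z r q)"
    using nz by (simp add: divide_simps) algebra
  ultimately have "((\<lambda>q. - C r * D q / z r q ^ 4) has_field_derivative hdet r q * (- 2 * q / D q - 4 * b / z r q)) (at q)"
    unfolding hdet_eq[OF rg] by simp
  then have "dq hdet r q = hdet r q * (- 2 * q / D q - 4 * b / z r q)"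
    by (rule dq_eqI[rotated 2]) (use rg in \<open>auto simp: hdet_eq\<close>)
  moreover have "dq hdet r q = ddq r q"
    unfolding dq_def by (rule DERIV_imp_deriv[OF hdet_der(2)[OF rg, unfolded dq_def]])
  ultimately show ?thesis by simp
qed

text \<open>The left side is (det h)'' by the product rule, the right side is the same via det *
  ((log det)'^2 + (log det)''). This gives the only combination of second derivatives of h that the
  curvature needs beyond det h'.\<close>

lemma hdet_rr:
  assumes rg: "reg r q"
  shows "h44 r q * dr (dr h11) r q + h11 r q * dr (dr h44) r q - 2 * h14 r q * dr (dr h14) r q
      + 2 * (dr h11 r q * dr h44 r q - dr h14 r q ^2)
    = hdet r q * ((C' r / C r - 4 / z r q)^2 + 2 / C r - C' r ^2 / C r ^2 + 4 / z r q ^2)" (is "?L = ?R")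
proof -
  have regroup: "t * l * l + (x - y + v) * t = t * (l^2 + x - y + v)" for t l x y v :: complex
    by algebra
  have nz: "z r q \<noteq> 0" "C r \<noteq> 0" using rg by (auto simp: reg_def)
  have "((\<lambda>r. ddr r q) has_field_derivative ?L) (at r)"
    by (rule derivative_eq_intros der_r der_rr rq_hol_kg rg refl | simp add: power2_eq_square algebra_simps)+
  moreover have "((\<lambda>r. hdet r q * (C' r / C r - 4 / z r q)) has_field_derivative
      ddr r q * (C' r / C r - 4 / z r q) + (2 / C r - C' r ^2 / C r ^2 + 4 / z r q ^2) * hdet r q) (at r)"
  proof (rule DERIV_mult[OF hdet_der(1)[OF rg]])
    show "((\<lambda>r. C' r / C r - 4 / z r q) has_field_derivative 2 / C r - C' r ^2 / C r ^2 + 4 / z r q ^2) (at r)"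
      using nz by (auto intro!: derivative_eq_intros elem_der simp: field_simps power2_eq_square)
  qed
  then have "((\<lambda>r. ddr r q) has_field_derivative
      ddr r q * (C' r / C r - 4 / z r q) + (2 / C r - C' r ^2 / C r ^2 + 4 / z r q ^2) * hdet r q) (at r)"
    by (rule has_field_derivative_transform_within_open[OF _ open_reg(1)[of q]]) (use rg ddr_eq in auto)
  ultimately have "?L = ddr r q * (C' r / C r - 4 / z r q) + (2 / C r - C' r ^2 / C r ^2 + 4 / z r q ^2) * hdet r q"
    by (rule DERIV_unique)
  also have "\<dots> = ?R" unfolding ddr_eq[OF rg] by (rule regroup)
  finally show ?thesis .
qed

lemma hdet_qq:
  assumes rg: "reg r q"
  shows "h44 r q * dq (dq h11) r q + h11 r q * dq (dq h44) r q - 2 * h14 r q * dq (dq h14) r q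
      + 2 * (dq h11 r q * dq h44 r q - dq h14 r q ^2)
    = hdet r q * ((- 2 * q / D q - 4 * b / z r q)^2 - 2 / D q - 4 * q^2 / D q ^2 + 4 * b^2 / z r q ^2)" (is "?L = ?R")
proof -
  have regroup: "t * l * l + (- x / D q - y + v) * t = t * (l^2 - x / D q - y + v)" for t l x y v :: complex
    by (simp add: algebra_simps power2_eq_square)
  have nz: "z r q \<noteq> 0" "D q \<noteq> 0" using rg by (auto simp: reg_def)
  have "((\<lambda>q. ddq r q) has_field_derivative ?L) (at q)"
    by (rule derivative_eq_intros der_q der_qq rq_hol_kg rg refl | simp add: power2_eq_square algebra_simps)+
  moreover have "((\<lambda>q. hdet r q * (- 2 * q / D q - 4 * b / z r q)) has_field_derivative
      ddq r q * (- 2 * q / D q - 4 * b / z r q) + (- 2 / D q - 4 * q^2 / D q ^2 + 4 * b^2 / z r q ^2) * hdet r q) (at q)"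
  proof (rule DERIV_mult[OF hdet_der(2)[OF rg]])
    show "((\<lambda>q. - 2 * q / D q - 4 * b / z r q) has_field_derivative
        - 2 / D q - 4 * q^2 / D q ^2 + 4 * b^2 / z r q ^2) (at q)"
      using nz by (auto intro!: derivative_eq_intros elem_der simp: field_simps power2_eq_square)
  qed
  then have "((\<lambda>q. ddq r q) has_field_derivative
      ddq r q * (- 2 * q / D q - 4 * b / z r q) + (- 2 / D q - 4 * q^2 / D q ^2 + 4 * b^2 / z r q ^2) * hdet r q) (at q)"
    by (rule has_field_derivative_transform_within_open[OF _ open_reg(2)[of r]]) (use rg ddq_eq in auto)
  ultimately have "?L = ddq r q * (- 2 * q / D q - 4 * b / z r q)
      + (- 2 / D q - 4 * q^2 / D q ^2 + 4 * b^2 / z r q ^2) * hdet r q"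
    by (rule DERIV_unique)
  also have "\<dots> = ?R" unfolding ddq_eq[OF rg] by (rule regroup)
  finally show ?thesis .
qed

text \<open>The derivative of z^3 w is z^2 (3w + z), so a factor z^2 cancels and all three entries
  get the common denominator z^4 w^2.\<close>

lemma quotient_der_r:
  assumes "reg r q" "(N has_field_derivative N') (at r)"
  shows "((\<lambda>r. N r / (z r q ^ 3 * w r q)) has_field_derivative
     (N' * (z r q * w r q) - N r * (3 * w r q + z r q)) / (z r q ^ 4 * w r q ^ 2)) (at r)"
proof -
  have nz: "z r q \<noteq> 0" "w r q \<noteq> 0" using assms(1) by (auto simp: reg_def)
  show ?thesis
    by (rule derivative_eq_intros elem_der refl assms(2) | simp add: nz)+
       (use nz in \<open>simp add: divide_simps\<close>, algebra)
qed

lemma quotient_der_q: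
  assumes "reg r q" "(N has_field_derivative N') (at q)"
  shows "((\<lambda>q. N q / (z r q ^ 3 * w r q)) has_field_derivative
     (N' * (z r q * w r q) - N q * (b * (3 * w r q - z r q))) / (z r q ^ 4 * w r q ^ 2)) (at q)"
proof -
  have nz: "z r q \<noteq> 0" "w r q \<noteq> 0" using assms(1) by (auto simp: reg_def)
  show ?thesis
    by (rule derivative_eq_intros elem_der refl assms(2) | simp add: nz)+
       (use nz in \<open>simp add: divide_simps\<close>, algebra)
qed

lemma dh_r:
  assumes rg: "reg r q"
  shows "dr h11 r q = (- C' r * (z r q * w r q) - (aa^2 * D q - C r) * (3 * w r q + z r q)) / (z r q ^ 4 * w r q ^ 2)"
    "dr h14 r q = (- 2 * of_real M * aa * D q * (z r q * w r q) - (- 2 * of_real M * r * aa * D q) * (3 * w r q + z r q))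
       / (z r q ^ 4 * w r q ^ 2)"
    "dr h44 r q = (D q * (4 * r * (r^2 + aa^2) - aa^2 * C' r * D q) * (z r q * w r q)
       - D q * ((r^2 + aa^2)^2 - aa^2 * C r * D q) * (3 * w r q + z r q)) / (z r q ^ 4 * w r q ^ 2)"
  by (rule dr_eqI[OF rg], subst h11_def h14_def h44_def, rule refl, rule quotient_der_r[OF rg],
      (auto intro!: derivative_eq_intros elem_der simp: algebra_simps power2_eq_square)[1])+

lemma dh_q:
  assumes rg: "reg r q"
  shows "dq h11 r q = (- 2 * aa^2 * q * (z r q * w r q) - (aa^2 * D q - C r) * (b * (3 * w r q - z r q)))
       / (z r q ^ 4 * w r q ^ 2)"
    "dq h14 r q = (4 * of_real M * r * aa * q * (z r q * w r q)
       - (- 2 * of_real M * r * aa * D q) * (b * (3 * w r q - z r q))) / (z r q ^ 4 * w r q ^ 2)"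
    "dq h44 r q = (- 2 * q * ((r^2 + aa^2)^2 - 2 * aa^2 * C r * D q) * (z r q * w r q)
       - D q * ((r^2 + aa^2)^2 - aa^2 * C r * D q) * (b * (3 * w r q - z r q))) / (z r q ^ 4 * w r q ^ 2)"
  by (rule dq_eqI[OF rg], subst h11_def h14_def h44_def, rule refl, rule quotient_der_q[OF rg],
      (auto intro!: derivative_eq_intros elem_der simp: algebra_simps power2_eq_square)[1])+

text \<open>The determinant is a quadratic form on symmetric 2x2 matrices; the middle coefficient is
  its polarization, which for n' a derivative is the derivative of the determinant.\<close>

lemma det_num_identity:
  fixes p S n n' m m' k k' :: complex
  shows "(n' * p - n * S) * (k' * p - k * S) - (m' * p - m * S)^2
    = p^2 * (n' * k' - m'^2) - p * S * (n' * k + n * k' - 2 * m * m') + S^2 * (n * k - m^2)"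
  by algebra

lemma det_dh_r:
  assumes rg: "reg r q"
  shows "dr h11 r q * dr h44 r q - dr h14 r q ^2 =
    D q * (C' r * (z r q * w r q) * (w r q - z r q) - C r * (3 * w r q + z r q) * (w r q - z r q) - 4 * aa^2 * r^2 * D q)
      / (z r q ^ 6 * w r q ^ 2)"
proof -
  define zz ww where zz: "zz = z r q" and ww: "ww = w r q"
  have nz: "zz \<noteq> 0" "ww \<noteq> 0" using rg by (auto simp: reg_def zz ww)
  have combine: "x / (zz^4 * ww^2) * (y / (zz^4 * ww^2)) - (v / (zz^4 * ww^2))^2 = (x * y - v^2) / (zz^8 * ww^4)"
    for x y v
  proof -
    have "x / k * (y / k) - (v / k)^2 = (x * y - v^2) / (k * k)" for k :: complex
      by (simp add: diff_divide_distrib power2_eq_square)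
    moreover have "(zz^4 * ww^2) * (zz^4 * ww^2) = zz^8 * ww^4" by algebra
    ultimately show ?thesis by metis
  qed
  define p S where p: "p = zz * ww" and S: "S = 3 * ww + zz"
  define N11 N14 N44 where N: "N11 = aa^2 * D q - C r" "N14 = - 2 * of_real M * r * aa * D q"
    "N44 = D q * ((r^2 + aa^2)^2 - aa^2 * C r * D q)"
  define N11' N14' N44' where N': "N11' = - C' r" "N14' = - 2 * of_real M * aa * D q"
    "N44' = D q * (4 * r * (r^2 + aa^2) - aa^2 * C' r * D q)"
  have cancel: "p^2 * t / (zz^8 * ww^4) = t / (zz^6 * ww^2)" for t
  proof -
    have "zz^8 * ww^4 = p^2 * (zz^6 * ww^2)" unfolding p by algebra
    then show ?thesis using nz p by simp
  qed
  have p': "p = r^2 + aa^2 * q^2" unfolding p zz ww by (rule zw)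
  have E1: "N11' * N44' - N14'^2 = - 4 * r * C' r * D q * p - 4 * aa^2 * r^2 * D q ^2"
    unfolding N' p' D_def by algebra
  \<comment> \<open>This is the r-derivative of the determinant -C D p^2 in \<open>E3\<close>, hence
    it still has a factor p. All three terms of the expansion are thus divisible by p^2, which
    reduces the denominator.\<close>
  have E2: "N11' * N44 + N11 * N44' - 2 * N14 * N14' = - D q * (C' r * p^2 + 4 * r * C r * p)"
    unfolding N N' p' D_def C_def by algebra
  have E3: "N11 * N44 - N14^2 = - C r * D q * p^2"
    unfolding N p' D_def C_def by algebra
  have rr: "2 * r = zz + ww" by (simp add: zz ww z_def w_def)
  have "dr h11 r q * dr h44 r q - dr h14 r q ^2
    = ((N11' * p - N11 * S) * (N44' * p - N44 * S) - (N14' * p - N14 * S)^2) / (zz ^ 8 * ww ^ 4)"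
    unfolding dh_r[OF rg] N N' p S zz[symmetric] ww[symmetric] by (rule combine)
  also have "\<dots> = p^2 * (D q * (C' r * p * (ww - zz) - C r * S * (ww - zz) - 4 * aa^2 * r^2 * D q)) / (zz ^ 8 * ww ^ 4)"
  proof -
    have "4 * r = 2 * zz + 2 * ww" using rr by algebra
    then have "p^2 * (N11' * N44' - N14'^2) - p * S * (N11' * N44 + N11 * N44' - 2 * N14 * N14')
       + S^2 * (N11 * N44 - N14^2) = p^2 * (D q * (C' r * p * (ww - zz) - C r * S * (ww - zz) - 4 * aa^2 * r^2 * D q))"
      unfolding E1 E2 E3 S by algebra
    then show ?thesis unfolding det_num_identity by simp
  qed
  also have "\<dots> = D q * (C' r * p * (ww - zz) - C r * S * (ww - zz) - 4 * aa^2 * r^2 * D q) / (zz ^ 6 * ww ^ 2)"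
    by (rule cancel)
  finally show ?thesis unfolding p S zz ww .
qed

lemma det_dh_q:
  assumes rg: "reg r q"
  shows "dq h11 r q * dq h44 r q - dq h14 r q ^2 =
    C r * (4 * aa^2 * q^2 * (2 * (z r q * w r q) - C r) + b * (3 * w r q - z r q) * (4 * aa^2 * D q * q - 2 * q * (z r q * w r q))
        + aa^2 * (3 * w r q - z r q)^2 * D q) / (z r q ^ 6 * w r q ^ 2)"
proof -
  define zz ww where zz: "zz = z r q" and ww: "ww = w r q"
  have nz: "zz \<noteq> 0" "ww \<noteq> 0" using rg by (auto simp: reg_def zz ww)
  have combine: "x / (zz^4 * ww^2) * (y / (zz^4 * ww^2)) - (v / (zz^4 * ww^2))^2 = (x * y - v^2) / (zz^8 * ww^4)"
    for x y v
  proof -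
    have "x / k * (y / k) - (v / k)^2 = (x * y - v^2) / (k * k)" for k :: complex
      by (simp add: diff_divide_distrib power2_eq_square)
    moreover have "(zz^4 * ww^2) * (zz^4 * ww^2) = zz^8 * ww^4" by algebra
    ultimately show ?thesis by metis
  qed
  define p S where p: "p = zz * ww" and S: "S = b * (3 * ww - zz)"
  define N11 N14 N44 where N: "N11 = aa^2 * D q - C r" "N14 = - 2 * of_real M * r * aa * D q"
    "N44 = D q * ((r^2 + aa^2)^2 - aa^2 * C r * D q)"
  define N11' N14' N44' where N': "N11' = - 2 * aa^2 * q" "N14' = 4 * of_real M * r * aa * q"
    "N44' = - 2 * q * ((r^2 + aa^2)^2 - 2 * aa^2 * C r * D q)"
  have cancel: "p^2 * t / (zz^8 * ww^4) = t / (zz^6 * ww^2)" for t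
  proof -
    have "zz^8 * ww^4 = p^2 * (zz^6 * ww^2)" unfolding p by algebra
    then show ?thesis using nz p by simp
  qed
  have p': "p = r^2 + aa^2 * q^2" unfolding p zz ww by (rule zw)
  have E1: "N11' * N44' - N14'^2 = 4 * aa^2 * q^2 * C r * (2 * p - C r)"
    unfolding N' p' D_def C_def by algebra
  have E2: "N11' * N44 + N11 * N44' - 2 * N14 * N14' = - C r * (- 2 * q * p^2 + 4 * aa^2 * D q * q * p)"
    unfolding N N' p' D_def C_def by algebra
  have E3: "N11 * N44 - N14^2 = - C r * D q * p^2"
    unfolding N p' D_def C_def by algebra
  have SS: "S^2 = - (aa^2) * (3 * ww - zz)^2" unfolding S power_mult_distrib by simp
  have "dq h11 r q * dq h44 r q - dq h14 r q ^2
    = ((N11' * p - N11 * S) * (N44' * p - N44 * S) - (N14' * p - N14 * S)^2) / (zz ^ 8 * ww ^ 4)"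
    unfolding dh_q[OF rg] N N' p S zz[symmetric] ww[symmetric] by (rule combine)
  also have "\<dots> = p^2 * (C r * (4 * aa^2 * q^2 * (2 * p - C r) + S * (4 * aa^2 * D q * q - 2 * q * p)
        + aa^2 * (3 * ww - zz)^2 * D q)) / (zz ^ 8 * ww ^ 4)"
    unfolding det_num_identity E1 E2 E3 SS by (rule arg_cong[where f = "\<lambda>t. t / _"]) algebra
  also have "\<dots> = C r * (4 * aa^2 * q^2 * (2 * p - C r) + S * (4 * aa^2 * D q * q - 2 * q * p)
        + aa^2 * (3 * ww - zz)^2 * D q) / (zz ^ 6 * ww ^ 2)"
    by (rule cancel)
  finally show ?thesis unfolding p S zz ww by simp
qed

lemma scal_eq:
  assumes x: "x \<in> U"
  shows "scal M a x = 12 * of_real M * lamp a x"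
proof -
  define r q where rq: "r = complex_of_real (x$2)" "q = complex_of_real (x$3)"
  have rg: "reg r q" using U_reg[OF x] by (simp add: rq)
  define zz ww c d where defs: "zz = z r q" "ww = w r q" "c = C r" "d = D q"
  \<comment> \<open>Naming ia makes the remaining identities polynomial over an ordinary
    indeterminate B, with a^2 replaced by -B^2.\<close>
  define B where "B = b"
  have aB: "aa^2 = - (B^2)" by (simp add: B_def power_mult_distrib)
  have nz: "zz \<noteq> 0" "ww \<noteq> 0" "c \<noteq> 0" "d \<noteq> 0" using rg by (auto simp: reg_def defs)
  define f g u where fgu: "f = inverse (e2 r q)" "g = inverse (e3 r q)" "u = inverse (hdet r q)"
  note fold = defs[symmetric] B_def[symmetric]
  have f: "f = zz * c / ww" and g: "g = zz * d / ww" and u: "u = - (zz^4) / (c * d)"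
    and dtu: "hdet r q * u = 1"
    using reg_nz[OF rg] nz by (simp_all add: fgu e2_def e3_def hdet_eq[OF rg] fold)
  have e2r: "dr e2 r q * f = 1 / ww - 1 / zz - C' r / c" and e3q: "dq e3 r q * g = - B / ww - B / zz + 2 * q / d"
    using reg_nz[OF rg] by (simp_all add: dr_e2[OF rg] dq_e3[OF rg] fgu fold)
  have e2q: "dq e2 r q * f = - 2 * B * r / (zz * ww)" and e3r: "dr e3 r q * g = 2 * B * q / (zz * ww)"
    and e2qq: "dq (dq e2) r q * f = 4 * B^2 * r / (zz^2 * ww)" and e3rr: "dr (dr e3) r q * g = - 4 * B * q / (zz^2 * ww)"
    using nz unfolding dq_e2[OF rg] dr_e3[OF rg] dqq_e2[OF rg] drr_e3[OF rg] f g aB fold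
    by (simp_all add: divide_simps power2_eq_square power3_eq_cube)
  have zw': "zz = r + B * q" "ww = r - B * q" by (simp_all add: defs z_def w_def B_def)
  have diff: "dr e2 r q * f - dr e3 r q * g = - C' r / c" "dq e3 r q * g - dq e2 r q * f = 2 * q / d"
    unfolding e2r e3r e3q e2q using nz by (simp_all add: divide_simps) (simp_all add: zw' algebra_simps)
  define Yr where "Yr = C' r * (zz * ww) * (ww - zz) - c * (3 * ww + zz) * (ww - zz) - 4 * aa^2 * r^2 * d"
  define Yq where "Yq = 4 * aa^2 * q^2 * (2 * (zz * ww) - c) + B * (3 * ww - zz) * (4 * aa^2 * d * q - 2 * q * (zz * ww))
        + aa^2 * (3 * ww - zz)^2 * d"
  have dr': "(dr h11 r q * dr h44 r q - dr h14 r q ^2) * u = - Yr / (c * zz^2 * ww^2)"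
    unfolding det_dh_r[OF rg] fold Yr_def[symmetric] u using nz by (simp add: divide_simps)
  have dq': "(dq h11 r q * dq h44 r q - dq h14 r q ^2) * u = - Yq / (d * zz^2 * ww^2)"
    unfolding det_dh_q[OF rg] fold Yq_def[symmetric] u using nz by (simp add: divide_simps)
  define L where "L = C' r / c - 4 / zz"
  define K where "K = - 2 * q / d - 4 * B / zz"
  have Lu: "ddr r q * u = L" and Ku: "ddq r q * u = K"
    using dtu unfolding ddr_eq[OF rg] ddq_eq[OF rg] L_def K_def fold by (simp_all add: mult.commute mult.left_commute)
  let ?Xr = "h44 r q * dr (dr h11) r q + h11 r q * dr (dr h44) r q - 2 * h14 r q * dr (dr h14) r q"
  let ?Xq = "h44 r q * dq (dq h11) r q + h11 r q * dq (dq h44) r q - 2 * h14 r q * dq (dq h14) r q"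
  let ?dr = "dr h11 r q * dr h44 r q - dr h14 r q ^2" and ?dq = "dq h11 r q * dq h44 r q - dq h14 r q ^2"
  have Xr: "?Xr * u + 2 * (?dr * u) = L^2 + 2 / c - C' r ^2 / c^2 + 4 / zz^2"
  proof -
    have "?Xr * u + 2 * (?dr * u) = (?Xr + 2 * ?dr) * u" by (simp add: algebra_simps)
    also have "\<dots> = (hdet r q * u) * (L^2 + 2 / c - C' r ^2 / c^2 + 4 / zz^2)"
      unfolding hdet_rr[OF rg] L_def fold by (simp only: mult_ac)
    finally show ?thesis by (simp add: dtu)
  qed
  have Xq: "?Xq * u + 2 * (?dq * u) = K^2 - 2 / d - 4 * q^2 / d^2 + 4 * B^2 / zz^2"
  proof -
    have "?Xq * u + 2 * (?dq * u) = (?Xq + 2 * ?dq) * u" by (simp add: algebra_simps)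
    also have "\<dots> = (hdet r q * u) * (K^2 - 2 / d - 4 * q^2 / d^2 + 4 * B^2 / zz^2)"
      unfolding hdet_qq[OF rg] K_def fold by (simp only: mult_ac)
    finally show ?thesis by (simp add: dtu)
  qed
  \<comment> \<open>The coefficient -3/2 of det h' is split as -2 + 1/2, so that \<open>Xr\<close>
    and \<open>Xq\<close> absorb all second derivatives of h.\<close>
  have "scal M a x = (- g * (dq (dq e2) r q * f) - f * (dr (dr e3) r q * g)
      + (g * (dq e2 r q * f)^2 + g * (dq e2 r q * f) * (dq e3 r q * g) + f * (dr e3 r q * g)^2
         + f * (dr e3 r q * g) * (dr e2 r q * f)) / 2)
    + f * (- (?Xr * u + 2 * (?dr * u)) + (?dr * u) / 2 + (ddr r q * u)^2 / 2
        + (ddr r q * u) / 2 * (dr e2 r q * f - dr e3 r q * g))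
    + g * (- (?Xq * u + 2 * (?dq * u)) + (?dq * u) / 2 + (ddq r q * u)^2 / 2
        + (ddq r q * u) / 2 * (dq e3 r q * g - dq e2 r q * f))"
    unfolding scal_block[OF x rq fgu] by (simp add: field_simps power2_eq_square)
  also have "\<dots> = (- g * (4 * B^2 * r / (zz^2 * ww)) - f * (- 4 * B * q / (zz^2 * ww))
      + (g * (- 2 * B * r / (zz * ww))^2 + g * (- 2 * B * r / (zz * ww)) * (- B / ww - B / zz + 2 * q / d)
         + f * (2 * B * q / (zz * ww))^2 + f * (2 * B * q / (zz * ww)) * (1 / ww - 1 / zz - C' r / c)) / 2)
    + f * (- (L^2 + 2 / c - C' r ^2 / c^2 + 4 / zz^2) + (- Yr / (c * zz^2 * ww^2)) / 2 + L^2 / 2 + L / 2 * (- C' r / c))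
    + g * (- (K^2 - 2 / d - 4 * q^2 / d^2 + 4 * B^2 / zz^2) + (- Yq / (d * zz^2 * ww^2)) / 2 + K^2 / 2 + K / 2 * (2 * q / d))"
    unfolding Xr Xq unfolding diff unfolding dr' dq' Lu Ku e2qq e3rr e2q e3r e3q e2r ..
  also have "f * (- (L^2 + 2 / c - C' r ^2 / c^2 + 4 / zz^2) + (- Yr / (c * zz^2 * ww^2)) / 2 + L^2 / 2 + L / 2 * (- C' r / c))
     = zz / ww * (- 2 + 6 * C' r / zz - 12 * c / zz^2 - Yr / (2 * zz^2 * ww^2))"
    unfolding f L_def using nz by (simp add: divide_simps) algebra
  also have "g * (- (K^2 - 2 / d - 4 * q^2 / d^2 + 4 * B^2 / zz^2) + (- Yq / (d * zz^2 * ww^2)) / 2 + K^2 / 2 + K / 2 * (2 * q / d))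
     = zz / ww * (2 - 12 * B * q / zz - 12 * B^2 * d / zz^2 - Yq / (2 * zz^2 * ww^2))"
    unfolding g K_def using nz by (simp add: divide_simps) algebra
  also have "(- g * (4 * B^2 * r / (zz^2 * ww)) - f * (- 4 * B * q / (zz^2 * ww))
      + (g * (- 2 * B * r / (zz * ww))^2 + g * (- 2 * B * r / (zz * ww)) * (- B / ww - B / zz + 2 * q / d)
         + f * (2 * B * q / (zz * ww))^2 + f * (2 * B * q / (zz * ww)) * (1 / ww - 1 / zz - C' r / c)) / 2)
     = zz / ww * ((- 4 * B^2 * r * d + 4 * B * q * c) / (zz^2 * ww) + (4 * B^2 * r^2 * d + 4 * B^2 * q^2 * c) / (zz^2 * ww^2)
         - (2 * B * r * q + B * q * C' r) / (zz * ww))"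
  proof -
    have E: "- B / ww - B / zz = - 2 * B * r / (zz * ww)" "1 / ww - 1 / zz = 2 * B * q / (zz * ww)"
      using nz by (simp_all add: divide_simps) (simp_all add: zw' algebra_simps)
    show ?thesis unfolding E f g using nz by (simp add: divide_simps) algebra
  qed
  also have "zz / ww * ((- 4 * B^2 * r * d + 4 * B * q * c) / (zz^2 * ww) + (4 * B^2 * r^2 * d + 4 * B^2 * q^2 * c) / (zz^2 * ww^2)
         - (2 * B * r * q + B * q * C' r) / (zz * ww))
     + zz / ww * (- 2 + 6 * C' r / zz - 12 * c / zz^2 - Yr / (2 * zz^2 * ww^2))
     + zz / ww * (2 - 12 * B * q / zz - 12 * B^2 * d / zz^2 - Yq / (2 * zz^2 * ww^2)) = 12 * of_real M / zz"
  proof -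
    have cB: "c = r^2 - 2 * of_real M * r - B^2" and dB: "d = 1 - q^2" by (simp_all add: defs C_def D_def aB)
    \<comment> \<open>The claim divided by z/w and multiplied by 2 z^2 w^2; the constants -2 and 2
      of the r and q parts have already cancelled.\<close>
    have P: "(- 4 * B^2 * r * d + 4 * B * q * c) * (2 * ww) + 2 * (4 * B^2 * r^2 * d + 4 * B^2 * q^2 * c)
         - 2 * (2 * B * r * q + B * q * C' r) * (zz * ww)
       + 12 * C' r * zz * ww^2 - 24 * c * ww^2 - Yr - 24 * B * q * zz * ww^2 - 24 * B^2 * d * ww^2 - Yq
       = 24 * of_real M * ww^3"
      unfolding Yr_def Yq_def aB cB dB zw' by algebra
    show ?thesis using nz by (simp add: divide_simps) (use P in algebra)
  qed
  finally show ?thesis by (simp add: lamp_eq rq defs)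
qed

subsection \<open>The conjugated operator\<close>

text \<open>\<open>P\<close> and \<open>Q\<close> are the components of \<open>d log (sqrt (CD) \<lambda>\<^sub>+\<^sup>2)\<close> in \<open>dr\<close> and \<open>dq\<close>.\<close>

definition P :: "complex \<Rightarrow> complex \<Rightarrow> complex" where "P r q = C' r / (2 * C r) - 2 / z r q"
definition Q :: "complex \<Rightarrow> complex \<Rightarrow> complex" where "Q r q = - q / D q - 2 * b / z r q"

definition ka :: "4 \<Rightarrow> complex \<Rightarrow> complex \<Rightarrow> complex" where
  "ka i r q = (if i = 1 then (\<i> * C r * P r q - aa * D q * Q r q) / (z r q * w r q)
     else if i = 4 then (- \<i> * aa * D q * C r * P r q + (r^2 + aa^2) * D q * Q r q) / (z r q * w r q) else 0)"

lemma aform_eq: "aform M a y i = ka i (of_real (y$2)) (of_real (y$3))"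
proof -
  have "(Delta M a has_real_derivative 2 * y$2 - 2 * M) (at (y$2))"
    unfolding Delta_def by (auto intro!: derivative_eq_intros)
  then have d: "deriv (Delta M a) (y$2) = 2 * y$2 - 2 * M" by (rule DERIV_imp_deriv)
  have "(Dfun has_real_derivative - 2 * y$3) (at (y$3))"
    unfolding Dfun_def by (auto intro!: derivative_eq_intros)
  then have d': "deriv Dfun (y$3) = - 2 * y$3" by (rule DERIV_imp_deriv)
  define r q where rq: "r = complex_of_real (y$2)" "q = complex_of_real (y$3)"
  have "aform M a y i = \<i> * (C r / (z r q * w r q)) * P r q * of_real (Aco a y i)
      - D q / (z r q * w r q) * Q r q * of_real (Bco a y i)"
    unfolding aform_def d d' lamp_eq P_def Q_def rq
    by (simp add: of_real_rho2 of_real_Delta of_real_Dfun)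
  also have "\<dots> = ka i r q"
    using exhaust_4[of i]
    by (elim disjE; simp add: Aco_def Bco_def ka_def rq of_real_Dfun)
       (simp_all add: add_divide_distrib diff_divide_distrib algebra_simps)
  finally show ?thesis by (simp add: rq)
qed

text \<open>The common factor z/w is z^2 / rho^2, the inverse conformal factor times 1/rho^2; what
  is left are, up to sign, the second-order coefficients of the Teukolsky operator in t, phi, r and
  q.\<close>

lemma kinv_eq:
  assumes rg: "reg r q"
  shows "kinv 1 1 r q = z r q / w r q * (aa^2 * D q - (r^2 + aa^2)^2 / C r)"
    "kinv 1 4 r q = z r q / w r q * (aa - (r^2 + aa^2) * aa / C r)"
    "kinv 4 4 r q = z r q / w r q * (1 / D q - aa^2 / C r)"
    "kinv 2 2 r q = z r q / w r q * C r" "kinv 3 3 r q = z r q / w r q * D q"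
proof -
  have nz: "z r q \<noteq> 0" "w r q \<noteq> 0" "C r \<noteq> 0" "D q \<noteq> 0" using rg by (auto simp: reg_def)
  \<comment> \<open>Eliminating M lets C be treated as a free symbol in the polynomial identities
    below.\<close>
  have m: "2 * of_real M * r = r^2 + aa^2 - C r" by (simp add: C_def)
  have h14: "h14 r q = - (r^2 + aa^2 - C r) * aa * D q / (z r q ^ 3 * w r q)"
    unfolding m[symmetric] by (simp add: h14_def)
  show "kinv 1 1 r q = z r q / w r q * (aa^2 * D q - (r^2 + aa^2)^2 / C r)"
    unfolding kinv_table hdet_eq[OF rg] h44_def using nz by (simp add: divide_simps) algebra
  show "kinv 1 4 r q = z r q / w r q * (aa - (r^2 + aa^2) * aa / C r)"
    unfolding kinv_table hdet_eq[OF rg] h14 using nz by (simp add: divide_simps) algebra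
  show "kinv 4 4 r q = z r q / w r q * (1 / D q - aa^2 / C r)"
    unfolding kinv_table hdet_eq[OF rg] h11_def using nz by (simp add: divide_simps) algebra
  show "kinv 2 2 r q = z r q / w r q * C r" "kinv 3 3 r q = z r q / w r q * D q"
    unfolding kinv_table e2_def e3_def using nz by simp_all
qed

text \<open>The components a^t and a^phi, then the square of \<open>a\<close> without the factor
  z/w. The square equals that of P dr + Q dq because the endomorphism J is an isometry.\<close>

lemma ka_raised:
  assumes rg: "reg r q"
  shows "kinv 1 1 r q * ka 1 r q + kinv 1 4 r q * ka 4 r q
      = z r q / w r q * (Q r q * aa * D q - \<i> * P r q * (r^2 + aa^2))" (is ?t)
    and "kinv 1 4 r q * ka 1 r q + kinv 4 4 r q * ka 4 r q = z r q / w r q * (Q r q - \<i> * P r q * aa)" (is ?p)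
    and "ka 1 r q * (Q r q * aa * D q - \<i> * P r q * (r^2 + aa^2)) + ka 4 r q * (Q r q - \<i> * P r q * aa)
      = C r * P r q ^2 + D q * Q r q ^2" (is ?n)
proof -
  have nz: "z r q \<noteq> 0" "w r q \<noteq> 0" "C r \<noteq> 0" "D q \<noteq> 0" using rg by (auto simp: reg_def)
  define p where "p = z r q * w r q"
  have regroup: "t * x * u + t * y * v = t * (x * u + y * v)" for t x y u v :: complex
    by algebra
  \<comment> \<open>With this substitution p, C, D, P, Q and a become independent symbols;
    \<open>j\<close> below plays the same role for the imaginary unit, with j^2 = -1 used only for
    the square.\<close>
  have p: "r^2 + aa^2 = p + aa^2 * D q" unfolding p_def zw by (simp add: D_def algebra_simps)
  have p0: "p \<noteq> 0" using nz by (simp add: p_def)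
  define j where "j = \<i>"
  have j: "j^2 = - 1" by (simp add: j_def)
  have k14: "ka 1 r q = (j * C r * P r q - aa * D q * Q r q) / p"
    "ka 4 r q = (- j * aa * D q * C r * P r q + (p + aa^2 * D q) * D q * Q r q) / p"
    by (simp_all add: ka_def p p_def[symmetric] j_def)
  have "(aa^2 * D q - (p + aa^2 * D q)^2 / C r) * ka 1 r q + (aa - (p + aa^2 * D q) * aa / C r) * ka 4 r q
      = Q r q * aa * D q - j * P r q * (p + aa^2 * D q)"
    unfolding k14 using nz p0 by (simp add: divide_simps) algebra
  then show ?t unfolding kinv_eq[OF rg] regroup p j_def by simp
  have "(aa - (p + aa^2 * D q) * aa / C r) * ka 1 r q + (1 / D q - aa^2 / C r) * ka 4 r q
      = Q r q - j * P r q * aa"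
    unfolding k14 using nz p0 by (simp add: divide_simps) algebra
  then show ?p unfolding kinv_eq[OF rg] regroup p j_def by simp
  have num: "(j * c * x - e * d * y) * (y * e * d - j * x * (p + e^2 * d))
      + (- j * e * d * c * x + (p + e^2 * d) * d * y) * (y - j * x * e) = p * (- (j^2) * c * x^2 + d * y^2)"
    for c d e x y by algebra
  have frac: "t / p * u + v / p * s = (t * u + v * s) / p" for t u v s by (simp add: add_divide_distrib)
  have "ka 1 r q * (Q r q * aa * D q - j * P r q * (p + aa^2 * D q)) + ka 4 r q * (Q r q - j * P r q * aa)
      = C r * P r q ^2 + D q * Q r q ^2"
    unfolding k14 frac num j using p0 by simp
  then show ?n unfolding p j_def .
qed

text \<open>This is g^{ij} Gamma^c_{ij} = -(1/v) d_c (v g^{cc}) with volume density v = w/z^3 up to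
  a constant, since hdet * e2 * e3 = -w^2/z^6. Thus v g^{22} = C/z^2 and v g^{33} = D/z^2, whose
  derivatives give the right sides.\<close>

lemma Gam_contracted:
  assumes rg: "reg r q"
  shows "kinv 1 1 r q * kGam 2 1 1 r q + 2 * kinv 1 4 r q * kGam 2 1 4 r q + kinv 4 4 r q * kGam 2 4 4 r q
      + kinv 2 2 r q * kGam 2 2 2 r q + kinv 3 3 r q * kGam 2 3 3 r q
      = - (z r q / w r q * (C' r - 2 * C r / z r q))" (is "?L2 = _")
    and "kinv 1 1 r q * kGam 3 1 1 r q + 2 * kinv 1 4 r q * kGam 3 1 4 r q + kinv 4 4 r q * kGam 3 4 4 r q
      + kinv 2 2 r q * kGam 3 2 2 r q + kinv 3 3 r q * kGam 3 3 3 r q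
      = - (z r q / w r q * (- 2 * q - 2 * b * D q / z r q))" (is "?L3 = _")
proof -
  have nz: "z r q \<noteq> 0" "w r q \<noteq> 0" "C r \<noteq> 0" "D q \<noteq> 0" using rg by (auto simp: reg_def)
  note nz' = reg_nz[OF rg]
  have zw': "z r q - w r q = 2 * b * q" "z r q + w r q = 2 * r" by (simp_all add: z_def w_def algebra_simps)
  have f: "1 / e2 r q = z r q * C r / w r q" "1 / e3 r q = z r q * D q / w r q" by (simp_all add: e2_def e3_def)
  have inv: "inverse (hdet r q) = 1 / hdet r q" "inverse (e2 r q) = 1 / e2 r q" "inverse (e3 r q) = 1 / e3 r q"
    by (simp_all add: divide_inverse)
  have gen: "h / t * (- A * (1 / e) / 2) + 2 * (- m / t) * (- B * (1 / e) / 2) + n / t * (- E * (1 / e) / 2)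
      + 1 / e * (e' * (1 / e) / 2) + 1 / f * (- f' * (1 / e) / 2)
      = 1 / e * (e' / e - f' * (1 / f) - (h * A + n * E - 2 * m * B) / t) / 2" for h t A B E e m n e' f f' :: complex
    by (simp add: add_divide_distrib diff_divide_distrib algebra_simps)
  have gen': "x + y + v + c + d = x + y + v + d + c" for x y v c d :: complex by simp
  have "?L2 = 1 / e2 r q * (dr e2 r q / e2 r q - dr e3 r q * (1 / e3 r q) - ddr r q / hdet r q) / 2"
    unfolding kinv_table kGam_table inv by (rule gen)
  also have "dr e2 r q / e2 r q = 1 / w r q - 1 / z r q - C' r / C r" using nz' by (simp add: dr_e2[OF rg])
  also have "ddr r q / hdet r q = C' r / C r - 4 / z r q" using nz' by (simp add: ddr_eq[OF rg])
  also have "dr e3 r q * (1 / e3 r q) = 1 / w r q - 1 / z r q"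
    unfolding dr_e3[OF rg] f zw'(1)[symmetric] using nz by (simp add: divide_simps power2_eq_square)
  finally show "?L2 = - (z r q / w r q * (C' r - 2 * C r / z r q))"
    unfolding f by (rule trans) (use nz in \<open>simp add: divide_simps\<close>)
  have "?L3 = 1 / e3 r q * (dq e3 r q / e3 r q - dq e2 r q * (1 / e2 r q) - ddq r q / hdet r q) / 2"
    unfolding kinv_table kGam_table inv by (subst gen') (rule gen)
  also have "dq e3 r q / e3 r q = - b / w r q - b / z r q + 2 * q / D q" using nz' by (simp add: dq_e3[OF rg])
  also have "ddq r q / hdet r q = - 2 * q / D q - 4 * b / z r q" using nz' by (simp add: ddq_eq[OF rg])
  also have "dq e2 r q * (1 / e2 r q) = - b / w r q - b / z r q"
  proof -
    have e: "dq e2 r q = - b * (z r q + w r q) / (z r q ^2 * C r)" unfolding dq_e2[OF rg] zw' by simp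
    show ?thesis unfolding e f using nz by (simp add: divide_simps power2_eq_square) (simp add: algebra_simps)
  qed
  finally show "?L3 = - (z r q / w r q * (- 2 * q - 2 * b * D q / z r q))"
    unfolding f by (rule trans) (use nz in \<open>simp add: divide_simps\<close>)
qed

section \<open>Derivatives of the conjugated function\<close>

lemma has_pd_Delta_powr:
  assumes x: "x \<in> U"
  shows "has_pd 2 (\<lambda>y. of_real (Delta M a (y$2) powr e))
      (of_real (Delta M a (x$2) powr e) * (of_real e * C' (of_real (x$2)) / C (of_real (x$2)))) x"
    and "i \<noteq> 2 \<Longrightarrow> has_pd i (\<lambda>y. complex_of_real (Delta M a (y$2) powr e)) 0 x"
proof -
  have pos: "Delta M a (x$2) > 0" using x by (simp add: U_def)
  have "((\<lambda>s. Delta M a (x$2 + s)) has_real_derivative 2 * (x$2) - 2 * M) (at 0)"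
    unfolding Delta_def by (auto intro!: derivative_eq_intros)
  then have "((\<lambda>s. Delta M a (x$2 + s) powr e) has_real_derivative
      Delta M a (x$2) powr e * (e * (2 * (x$2) - 2 * M) / Delta M a (x$2))) (at 0)"
    by (rule DERIV_cong[OF DERIV_fun_powr]) (use pos in \<open>simp_all add: powr_diff\<close>)
  then have "((\<lambda>s. complex_of_real (Delta M a (x$2 + s) powr e)) has_vector_derivative
      of_real (Delta M a (x$2) powr e * (e * (2 * (x$2) - 2 * M) / Delta M a (x$2)))) (at 0)"
    unfolding has_real_derivative_iff_has_vector_derivative by (rule bounded_linear.has_vector_derivative[OF bounded_linear_of_real])
  then show "has_pd 2 (\<lambda>y. of_real (Delta M a (y$2) powr e))
      (of_real (Delta M a (x$2) powr e) * (of_real e * C' (of_real (x$2)) / C (of_real (x$2)))) x"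
    by (simp add: has_pd_def axis_def of_real_Delta)
  show "i \<noteq> 2 \<Longrightarrow> has_pd i (\<lambda>y. complex_of_real (Delta M a (y$2) powr e)) 0 x"
    by (simp add: has_pd_def axis_def)
qed

text \<open>\<open>lam k i\<close> is the logarithmic derivative \<open>\<partial>\<^sub>i log (C\<^bsup>k/2\<^esup> z)\<close> of the conjugating factor \<open>wt k\<close> below.\<close>

definition lam :: "real \<Rightarrow> 4 \<Rightarrow> complex \<Rightarrow> complex \<Rightarrow> complex" where
  "lam k i = (if i = 2 then (\<lambda>r q. of_real (k/2) * C' r / C r + 1 / z r q)
     else if i = 3 then (\<lambda>r q. b / z r q) else (\<lambda>_ _. 0))"

lemma hol_lam: "rq_hol (lam k i)"
proof -
  have "(\<lambda>r. z r q) holomorphic_on S" "(\<lambda>q. z r q) holomorphic_on S" "C holomorphic_on S" for r q S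
    unfolding z_def C_def by (auto intro!: holomorphic_intros)
  then show ?thesis
    unfolding rq_hol_def lam_def by (auto intro!: holomorphic_intros simp: reg_def)
qed

lemma dk_lam:
  assumes rg: "reg r q"
  shows "dr (lam k 2) r q = of_real (k/2) * (2 / C r - C' r ^2 / C r ^2) - 1 / z r q ^2"
    "dq (lam k 3) r q = aa^2 / z r q ^2"
proof -
  have nz: "z r q \<noteq> 0" "C r \<noteq> 0" using rg by (auto simp: reg_def)
  show "dr (lam k 2) r q = of_real (k/2) * (2 / C r - C' r ^2 / C r ^2) - 1 / z r q ^2"
    by (rule dr_eqI[where F = "\<lambda>r. of_real (k/2) * C' r / C r + 1 / z r q", OF rg])
      (use nz in \<open>auto simp: lam_def field_simps power2_eq_square intro!: derivative_eq_intros elem_der\<close>)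
  show "dq (lam k 3) r q = aa^2 / z r q ^2"
    by (rule dq_eqI[where F = "\<lambda>q. b / z r q", OF rg])
      (use nz in \<open>auto simp: lam_def field_simps power2_eq_square intro!: derivative_eq_intros elem_der\<close>)
qed

definition wt :: "real \<Rightarrow> pt \<Rightarrow> complex" where
  "wt k y = complex_of_real (Delta M a (y$2) powr (k/2)) / lamp a y"

lemma has_pd_wt:
  assumes x: "x \<in> U"
  shows "has_pd i (wt k) (wt k x * lam k i (of_real (x$2)) (of_real (x$3))) x"
proof -
  define r q where rq: "r = complex_of_real (x$2)" "q = complex_of_real (x$3)"
  have nz: "z r q \<noteq> 0" "C r \<noteq> 0" using U_reg[OF x] by (auto simp: reg_def rq)
  define zi where "zi = (if i = 2 then 1 else if i = 3 then b else 0)"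
  have Z: "has_pd i (\<lambda>y. z (of_real (y$2)) (of_real (y$3))) zi x"
    using exhaust_4[of i] has_pd_rq_1[of z x] has_pd_rq_4[of z x] has_pd_rq_2[of z x, OF elem_der(1)]
      has_pd_rq_3[of z x, OF elem_der(2)] unfolding zi_def by (elim disjE) simp_all
  define S where "S = (\<lambda>y::pt. complex_of_real (Delta M a (y$2) powr (k/2)))"
  have S: "has_pd i S (S x * (if i = 2 then of_real (k/2) * C' r / C r else 0)) x"
    using has_pd_Delta_powr(1)[OF x, of "k/2"] has_pd_Delta_powr(2)[OF x, of i "k/2"] unfolding rq S_def
    by (cases "i = 2") (simp_all only: if_True if_False mult_zero_right simp_thms)
  have wt: "wt k = (\<lambda>y. S y * z (of_real (y$2)) (of_real (y$3)))"
    by (simp add: wt_def lamp_eq S_def fun_eq_iff)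
  have "has_pd i (wt k) (S x * zi + S x * (if i = 2 then of_real (k/2) * C' r / C r else 0) * z r q) x"
    unfolding wt using has_pd_mult[OF S Z] unfolding rq .
  also have "S x * zi + S x * (if i = 2 then of_real (k/2) * C' r / C r else 0) * z r q = wt k x * lam k i r q"
    using nz by (simp add: wt rq[symmetric] zi_def lam_def distrib_left)
  finally show ?thesis by (simp add: rq)
qed

context
  fixes k :: real and Phi :: "pt \<Rightarrow> complex"
  assumes smooth: "smooth_on U Phi"
begin

abbreviation "F \<equiv> \<lambda>y. wt k y * Phi y"

lemma has_pd_Phi: "y \<in> U \<Longrightarrow> has_pd i Phi (pd i Phi y) y"
  and has_pd_pd_Phi: "y \<in> U \<Longrightarrow> has_pd i (pd j Phi) (pd i (pd j Phi) y) y"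
  using smooth smooth_on_pd[OF smooth]
  by (auto intro!: differentiable_imp_has_pd intro: smooth_on_imp_differentiable)

lemma has_pd_F:
  assumes "y \<in> U"
  shows "has_pd i F (wt k y * (lam k i (of_real (y$2)) (of_real (y$3)) * Phi y + pd i Phi y)) y"
  using has_pd_mult[OF has_pd_wt[OF assms] has_pd_Phi[OF assms]] by (simp add: algebra_simps)

lemma has_pd_pd_F:
  assumes x: "x \<in> U" and rq: "r = of_real (x$2)" "q = of_real (x$3)"
  shows "has_pd i (pd j F) (wt k x * (lam k i r q * (lam k j r q * Phi x + pd j Phi x)
      + dk i (lam k j) r q * Phi x + lam k j r q * pd i Phi x + pd i (pd j Phi) x)) x"
proof -
  have eq: "pd j F y = wt k y * (lam k j (of_real (y$2)) (of_real (y$3)) * Phi y + pd j Phi y)" if "y \<in> U" for y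
    by (rule has_pd_imp_pd[OF has_pd_F[OF that]])
  have lam: "has_pd i (\<lambda>y. lam k j (of_real (y$2)) (of_real (y$3))) (dk i (lam k j) r q) x"
    unfolding rq by (rule has_pd_dk[where f = "lam k j", OF hol_lam x])
  have "has_pd i (\<lambda>y. wt k y * (lam k j (of_real (y$2)) (of_real (y$3)) * Phi y + pd j Phi y))
     (wt k x * (lam k j r q * pd i Phi x + dk i (lam k j) r q * Phi x + pd i (pd j Phi) x)
      + wt k x * lam k i r q * (lam k j r q * Phi x + pd j Phi x)) x"
    using has_pd_mult[OF has_pd_wt[OF x] has_pd_add[OF has_pd_mult[OF lam has_pd_Phi[OF x]] has_pd_pd_Phi[OF x]]]
    by (simp add: rq)
  then show ?thesis
    using has_pd_cong_open[OF open_U x, of "pd j F"] eq by (simp add: algebra_simps)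
qed

text \<open>No derivative of \<open>ka\<close> survives, since its coefficients do not depend on t
  or phi; this is the divergence-freeness of \<open>a\<close> at the level of components. The weight
  \<open>wt k\<close> passes through for the same reason.\<close>

lemma pd_covD_tphi:
  assumes x: "x \<in> U" and rq: "r = of_real (x$2)" "q = of_real (x$3)" and i: "tphi i" and j: "tphi j"
  shows "pd i (\<lambda>y. covD M a k F y j) x = wt k x * (pd i (pd j Phi) x + \<i> * of_real k * ka j r q * pd i Phi x)"
proof -
  have l: "lam k i = (\<lambda>_ _. 0)" "lam k j = (\<lambda>_ _. 0)" using i j by (auto simp: lam_def)
  have A: "has_pd i (\<lambda>y. \<i> * of_real k * ka j (of_real (y$2)) (of_real (y$3))) 0 x"
    using i has_pd_rq_1[of "\<lambda>r q. \<i> * of_real k * ka j r q" x] has_pd_rq_4[of "\<lambda>r q. \<i> * of_real k * ka j r q" x] by auto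
  have 1: "has_pd i (pd j F) (wt k x * pd i (pd j Phi) x) x"
  proof -
    have "dk i (lam k j) r q = 0" by (simp add: l dk_def dr_dq_zero)
    then show ?thesis using has_pd_pd_F[OF x rq, of i j] by (simp add: l)
  qed
  have 2: "has_pd i F (wt k x * pd i Phi x) x"
    using has_pd_F[OF x, of i] by (simp add: l)
  have "has_pd i (\<lambda>y. covD M a k F y j) (wt k x * pd i (pd j Phi) x + \<i> * of_real k * ka j r q * (wt k x * pd i Phi x)) x"
    using has_pd_add[OF 1 has_pd_mult[OF A 2]] unfolding covD_def aform_eq rq
    by (simp only: mult_zero_left add_0_right)
  then show ?thesis by (simp add: has_pd_imp_pd algebra_simps)
qed

lemma covD_eq:
  assumes "x \<in> U" and rq: "r = of_real (x$2)" "q = of_real (x$3)"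
  shows "covD M a k F x j = wt k x * (lam k j r q * Phi x + pd j Phi x + \<i> * of_real k * ka j r q * Phi x)"
  unfolding covD_def aform_eq has_pd_imp_pd[OF has_pd_F[OF assms(1)]] rq by (simp add: algebra_simps)

lemma pd_covD_rq:
  assumes x: "x \<in> U" and rq: "r = of_real (x$2)" "q = of_real (x$3)" and j: "\<not> tphi j"
  shows "pd j (\<lambda>y. covD M a k F y j) x = wt k x * ((lam k j r q ^2 + dk j (lam k j) r q) * Phi x
      + 2 * lam k j r q * pd j Phi x + pd j (pd j Phi) x)"
proof -
  have "(\<lambda>y. covD M a k F y j) = pd j F" using j by (auto simp: covD_def aform_eq ka_def fun_eq_iff)
  then show ?thesis using has_pd_imp_pd[OF has_pd_pd_F[OF x rq, of j j]] by (simp add: algebra_simps power2_eq_square)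
qed

end

text \<open>By parity the contracted Christoffel symbol has only r and q components, on which
  \<open>a\<close> vanishes; hence the connection adds only the first-order terms in
  \<open>v 2\<close> and \<open>v 3\<close>.\<close>

lemma Oop_contracted:
  fixes G :: "pt \<Rightarrow> complex" and k :: real
  assumes x: "x \<in> U" and rq: "r = of_real (x$2)" "q = of_real (x$3)"
  defines "v \<equiv> covD M a k G x" and "p \<equiv> \<lambda>i j. pd i (\<lambda>y. covD M a k G y j) x" and "I \<equiv> \<i> * of_real k"
  shows "Oop M a k G x =
    - (kinv 1 1 r q * (p 1 1 + I * ka 1 r q * v 1) + kinv 1 4 r q * (p 1 4 + I * ka 1 r q * v 4)
       + kinv 1 4 r q * (p 4 1 + I * ka 4 r q * v 1) + kinv 4 4 r q * (p 4 4 + I * ka 4 r q * v 4)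
       + kinv 2 2 r q * p 2 2 + kinv 3 3 r q * p 3 3
       + z r q / w r q * (C' r - 2 * C r / z r q) * v 2
       + z r q / w r q * (- 2 * q - 2 * b * D q / z r q) * v 3)
    + of_real ((1 + 2 * k^2) / 6) * (12 * of_real M / z r q) * G x"
proof -
  have rg: "reg r q" using U_reg[OF x] by (simp add: rq)
  have k0: "kinv 1 2 r q = 0" "kinv 1 3 r q = 0" "kinv 2 1 r q = 0" "kinv 2 3 r q = 0" "kinv 2 4 r q = 0"
    "kinv 3 1 r q = 0" "kinv 3 2 r q = 0" "kinv 3 4 r q = 0" "kinv 4 2 r q = 0" "kinv 4 3 r q = 0"
    "kinv 4 1 r q = kinv 1 4 r q" by (simp_all add: kinv_table)
  have ka0: "ka 2 r q = 0" "ka 3 r q = 0" by (simp_all add: ka_def)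
  have c2: "z r q / w r q * (C' r - 2 * C r / z r q) = - (kinv 1 1 r q * kGam 2 1 1 r q + 2 * kinv 1 4 r q * kGam 2 1 4 r q
      + kinv 4 4 r q * kGam 2 4 4 r q + kinv 2 2 r q * kGam 2 2 2 r q + kinv 3 3 r q * kGam 2 3 3 r q)"
    unfolding Gam_contracted[OF rg] by simp
  have c3: "z r q / w r q * (- 2 * q - 2 * b * D q / z r q) = - (kinv 1 1 r q * kGam 3 1 1 r q + 2 * kinv 1 4 r q * kGam 3 1 4 r q
      + kinv 4 4 r q * kGam 3 4 4 r q + kinv 2 2 r q * kGam 3 2 2 r q + kinv 3 3 r q * kGam 3 3 3 r q)"
    unfolding Gam_contracted[OF rg] by simp
  have s: "scal M a x = 12 * of_real M / z r q" by (simp add: scal_eq[OF x] lamp_eq rq)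
  show ?thesis
    unfolding Oop_def sum_4 ginv_eq[OF x] aform_eq Gam_eq[OF x] rq[symmetric] k0 ka0 s c2 c3 v_def p_def I_def
    by (simp add: kGam_zero kGam_sym_table algebra_simps)
qed

lemma block_sum_identity:
  fixes I :: complex
  shows "g11 * (P11 + I * a1 * P1 + I * a1 * (P1 + I * a1 * P0)) + g14 * (P14 + I * a4 * P1 + I * a1 * (P4 + I * a4 * P0))
     + g14 * (P14 + I * a1 * P4 + I * a4 * (P1 + I * a1 * P0)) + g44 * (P44 + I * a4 * P4 + I * a4 * (P4 + I * a4 * P0))
   = g11 * P11 + 2 * g14 * P14 + g44 * P44 + 2 * I * ((g11 * a1 + g14 * a4) * P1 + (g14 * a1 + g44 * a4) * P4)
     + I^2 * (a1 * (g11 * a1 + g14 * a4) + a4 * (g14 * a1 + g44 * a4)) * P0"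
  by algebra

context
  fixes k :: real and Phi :: "pt \<Rightarrow> complex"
  assumes smooth: "smooth_on U Phi"
begin

lemma Oop_eq:
  assumes x: "x \<in> U" and rq: "r = of_real (x$2)" "q = of_real (x$3)"
  defines "l \<equiv> lam k 2 r q" and "m \<equiv> lam k 3 r q" and "R \<equiv> r^2 + aa^2"
  shows "Oop M a k (\<lambda>y. wt k y * Phi y) x = z r q / w r q * wt k x *
    ((R^2 / C r - aa^2 * D q) * pd 1 (pd 1 Phi) x + 2 * (R * aa / C r - aa) * pd 1 (pd 4 Phi) x
     + (aa^2 / C r - 1 / D q) * pd 4 (pd 4 Phi) x
     - 2 * (\<i> * of_real k) * ((Q r q * aa * D q - \<i> * P r q * R) * pd 1 Phi x + (Q r q - \<i> * P r q * aa) * pd 4 Phi x)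
     + of_real k ^2 * (C r * P r q ^2 + D q * Q r q ^2) * Phi x
     - C r * ((l^2 + dr (lam k 2) r q) * Phi x + 2 * l * pd 2 Phi x + pd 2 (pd 2 Phi) x)
     - (C' r - 2 * C r / z r q) * (l * Phi x + pd 2 Phi x)
     - D q * ((m^2 + dq (lam k 3) r q) * Phi x + 2 * m * pd 3 Phi x + pd 3 (pd 3 Phi) x)
     - (- 2 * q - 2 * b * D q / z r q) * (m * Phi x + pd 3 Phi x)
     + (1 + 2 * of_real k ^2) * (2 * of_real M * w r q / z r q ^2) * Phi x)"
proof -
  have rg: "reg r q" using U_reg[OF x] by (simp add: rq)
  have nz: "z r q \<noteq> 0" "w r q \<noteq> 0" using rg by (auto simp: reg_def)
  define I where "I = \<i> * complex_of_real k"
  have I2: "I^2 = - (of_real k ^2)" by (simp add: I_def power_mult_distrib)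
  let ?F = "\<lambda>y. wt k y * Phi y"
  have v: "covD M a k ?F x 1 = wt k x * (pd 1 Phi x + I * ka 1 r q * Phi x)"
    "covD M a k ?F x 4 = wt k x * (pd 4 Phi x + I * ka 4 r q * Phi x)"
    "covD M a k ?F x 2 = wt k x * (l * Phi x + pd 2 Phi x)"
    "covD M a k ?F x 3 = wt k x * (m * Phi x + pd 3 Phi x)"
    unfolding covD_eq[OF smooth x rq] l_def m_def I_def by (simp_all add: lam_def ka_def)
  have p: "pd i (\<lambda>y. covD M a k ?F y j) x = wt k x * (pd i (pd j Phi) x + I * ka j r q * pd i Phi x)"
    if "tphi i" "tphi j" for i j
    unfolding I_def by (rule pd_covD_tphi[OF smooth x rq that])
  have p2: "pd 2 (\<lambda>y. covD M a k ?F y 2) x = wt k x * ((l^2 + dr (lam k 2) r q) * Phi x + 2 * l * pd 2 Phi x + pd 2 (pd 2 Phi) x)"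
    and p3: "pd 3 (\<lambda>y. covD M a k ?F y 3) x = wt k x * ((m^2 + dq (lam k 3) r q) * Phi x + 2 * m * pd 3 Phi x + pd 3 (pd 3 Phi) x)"
    using pd_covD_rq[OF smooth x rq, of 2] pd_covD_rq[OF smooth x rq, of 3] by (simp_all add: l_def m_def dk_table)
  note pp = p[of 1 1, simplified] p[of 1 4, simplified] p[of 4 1, simplified] p[of 4 4, simplified]
  have factor: "- (g11 * (W * A1 + J * a1 * (W * B1)) + g14 * (W * A2 + J * a1 * (W * B4))
      + g14 * (W * A3 + J * a4 * (W * B1)) + g44 * (W * A4 + J * a4 * (W * B4))
      + X2 * (W * Y2) + X3 * (W * Y3) + U2 * (W * V2) + U3 * (W * V3)) + c * e * (W * H)
    = - W * (g11 * (A1 + J * a1 * B1) + g14 * (A2 + J * a1 * B4) + g14 * (A3 + J * a4 * B1) + g44 * (A4 + J * a4 * B4)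
      + X2 * Y2 + X3 * Y3 + U2 * V2 + U3 * V3 - c * e * H)"
    for g11 g14 g44 W A1 A2 A3 A4 J a1 a4 B1 B4 X2 X3 Y2 Y3 U2 U3 V2 V3 c e H :: complex
    by algebra
  have sign: "- W * (t * ((e1 - f1) * p11 + 2 * (e2 - f2) * p14 + (e3 - f3) * p44 + 2 * J * Y + (- K) * N * p0)
      + t * c * S2 + t * d * S3 + t * U2 * V2 + t * U3 * V3 - t * m0 * p0)
    = t * W * ((f1 - e1) * p11 + 2 * (f2 - e2) * p14 + (f3 - e3) * p44 - 2 * J * Y + K * N * p0
      - c * S2 - U2 * V2 - d * S3 - U3 * V3 + m0 * p0)"
    for W t e1 e2 e3 f1 f2 f3 p11 p14 p44 J Y K N p0 c d S2 S3 U2 V2 U3 V3 m0 :: complex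
    by algebra
  \<comment> \<open>The two off-diagonal entries of the inverse metric give both orders, which merge
    into one mixed term with factor 2.\<close>
  have comm: "pd 4 (pd 1 Phi) x = pd 1 (pd 4 Phi) x" by (rule pd_commute[OF open_U x smooth])
  let ?g = "\<lambda>i j. kinv i j r q" and ?a = "\<lambda>i. ka i r q"
  define Bl where "Bl = ?g 1 1 * (pd 1 (pd 1 Phi) x + I * ?a 1 * pd 1 Phi x + I * ?a 1 * (pd 1 Phi x + I * ?a 1 * Phi x))
     + ?g 1 4 * (pd 1 (pd 4 Phi) x + I * ?a 4 * pd 1 Phi x + I * ?a 1 * (pd 4 Phi x + I * ?a 4 * Phi x))
     + ?g 1 4 * (pd 1 (pd 4 Phi) x + I * ?a 1 * pd 4 Phi x + I * ?a 4 * (pd 1 Phi x + I * ?a 1 * Phi x))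
     + ?g 4 4 * (pd 4 (pd 4 Phi) x + I * ?a 4 * pd 4 Phi x + I * ?a 4 * (pd 4 Phi x + I * ?a 4 * Phi x))"
  have "Oop M a k ?F x = - wt k x * (Bl
       + z r q / w r q * C r * ((l^2 + dr (lam k 2) r q) * Phi x + 2 * l * pd 2 Phi x + pd 2 (pd 2 Phi) x)
       + z r q / w r q * D q * ((m^2 + dq (lam k 3) r q) * Phi x + 2 * m * pd 3 Phi x + pd 3 (pd 3 Phi) x)
       + z r q / w r q * (C' r - 2 * C r / z r q) * (l * Phi x + pd 2 Phi x)
       + z r q / w r q * (- 2 * q - 2 * b * D q / z r q) * (m * Phi x + pd 3 Phi x)
       - of_real ((1 + 2 * k^2) / 6) * (12 * of_real M / z r q) * Phi x)"
    unfolding Oop_contracted[OF x rq] v p2 p3 pp comm kinv_eq(4,5)[OF rg] I_def[symmetric] Bl_def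
    by (rule factor)
  also have "of_real ((1 + 2 * k^2) / 6) * (12 * of_real M / z r q)
      = z r q / w r q * ((1 + 2 * of_real k ^2) * (2 * of_real M * w r q / z r q ^2))"
    using nz by (simp add: field_simps power2_eq_square)
  also have "Bl = ?g 1 1 * pd 1 (pd 1 Phi) x + 2 * ?g 1 4 * pd 1 (pd 4 Phi) x + ?g 4 4 * pd 4 (pd 4 Phi) x
      + 2 * I * ((?g 1 1 * ?a 1 + ?g 1 4 * ?a 4) * pd 1 Phi x + (?g 1 4 * ?a 1 + ?g 4 4 * ?a 4) * pd 4 Phi x)
      + I^2 * (?a 1 * (?g 1 1 * ?a 1 + ?g 1 4 * ?a 4) + ?a 4 * (?g 1 4 * ?a 1 + ?g 4 4 * ?a 4)) * Phi x"
    unfolding Bl_def by (rule block_sum_identity)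
  also have "\<dots> = z r q / w r q * ((aa^2 * D q - R^2 / C r) * pd 1 (pd 1 Phi) x + 2 * (aa - R * aa / C r) * pd 1 (pd 4 Phi) x
      + (1 / D q - aa^2 / C r) * pd 4 (pd 4 Phi) x
      + 2 * I * ((Q r q * aa * D q - \<i> * P r q * R) * pd 1 Phi x + (Q r q - \<i> * P r q * aa) * pd 4 Phi x)
      + I^2 * (C r * P r q ^2 + D q * Q r q ^2) * Phi x)"
  proof -
    have n: "?a 1 * (z r q / w r q * (Q r q * aa * D q - \<i> * P r q * R)) + ?a 4 * (z r q / w r q * (Q r q - \<i> * P r q * aa))
        = z r q / w r q * (C r * P r q ^2 + D q * Q r q ^2)"
      unfolding ka_raised(3)[OF rg, symmetric] R_def by (simp only: ring_distribs mult_ac)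
    have "t * X1 * p11 + 2 * (t * X2) * p14 + t * X3 * p44 + 2 * I * (t * Y1 * p1 + t * Y4 * p4) + J * (t * N) * p0
        = t * (X1 * p11 + 2 * X2 * p14 + X3 * p44 + 2 * I * (Y1 * p1 + Y4 * p4) + J * N * p0)"
      for t X1 X2 X3 Y1 Y4 p11 p14 p44 p1 p4 p0 J N :: complex
      by algebra
    then show ?thesis
      unfolding ka_raised(1,2)[OF rg, folded R_def] n unfolding kinv_eq(1-3)[OF rg, folded R_def] .
  qed
  finally show ?thesis unfolding I2 I_def[symmetric] by (rule trans) (rule sign)
qed

end

section \<open>Comparison of coefficients with the Teukolsky operator\<close>

text \<open>The poles at z = 0 in P and Q cancel in these two combinations: in the first because r^2
  + a^2 - a^2 D = zw leaves only -2w, in the second outright.\<close>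

lemma first_order_coeffs:
  assumes rg: "reg r q"
  shows "P r q * (r^2 + aa^2) + \<i> * aa * D q * Q r q = of_real M * (r^2 - aa^2) / C r - r + \<i> * aa * q"
    and "P r q * aa + \<i> * Q r q = aa * (r - of_real M) / C r - \<i> * q / D q"
proof -
  have nz: "z r q \<noteq> 0" "w r q \<noteq> 0" "C r \<noteq> 0" "D q \<noteq> 0" using rg by (auto simp: reg_def)
  have "P r q * (r^2 + aa^2) + \<i> * aa * D q * Q r q
      = (r - of_real M) * (r^2 + aa^2) / C r - b * q - 2 * (r^2 + aa^2 - aa^2 * D q) / z r q"
    using nz unfolding P_def Q_def by (simp add: field_simps power2_eq_square)
  also have "r^2 + aa^2 - aa^2 * D q = z r q * w r q" unfolding zw D_def by (simp add: algebra_simps)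
  also have "(r - of_real M) * (r^2 + aa^2) = of_real M * (r^2 - aa^2) + r * C r"
    unfolding C_def by algebra
  also have "(of_real M * (r^2 - aa^2) + r * C r) / C r - b * q - 2 * (z r q * w r q) / z r q
      = of_real M * (r^2 - aa^2) / C r + r - b * q - 2 * w r q"
    using nz by (simp add: add_divide_distrib)
  finally show "P r q * (r^2 + aa^2) + \<i> * aa * D q * Q r q = of_real M * (r^2 - aa^2) / C r - r + \<i> * aa * q"
    by (simp add: w_def)
  show "P r q * aa + \<i> * Q r q = aa * (r - of_real M) / C r - \<i> * q / D q"
    using nz unfolding P_def Q_def by (simp add: field_simps)
qed

lemma zeroth_order_coeff:
  fixes k :: real
  assumes rg: "reg r q"
  defines "l \<equiv> lam k 2 r q" and "m \<equiv> lam k 3 r q"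
  shows "of_real k ^2 * (C r * P r q ^2 + D q * Q r q ^2)
      - C r * (l^2 + dr (lam k 2) r q) - (C' r - 2 * C r / z r q) * l
      - D q * (m^2 + dq (lam k 3) r q) - (- 2 * q - 2 * b * D q / z r q) * m
      + (1 + 2 * of_real k ^2) * (2 * of_real M * w r q / z r q ^2)
    = of_real k ^2 * q^2 / D q - of_real k"
proof -
  define c d zz B \<kappa> where defs: "c = C r" "d = D q" "zz = z r q" "B = b" "\<kappa> = complex_of_real k"
  have nz: "zz \<noteq> 0" "c \<noteq> 0" "d \<noteq> 0" using rg by (auto simp: reg_def defs)
  have aB: "aa^2 = - (B^2)" by (simp add: defs power_mult_distrib)
  have l: "l = \<kappa> / 2 * C' r / c + 1 / zz" and m: "m = B / zz" by (simp_all add: l_def m_def lam_def defs)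
  have lr: "dr (lam k 2) r q = \<kappa> / 2 * (2 / c - C' r ^2 / c^2) - 1 / zz^2"
    and mq: "dq (lam k 3) r q = - (B^2) / zz^2"
    unfolding dk_lam[OF rg] aB by (simp_all add: defs)
  \<comment> \<open>Y/z is the common multiple: -2Y/z occurs in the square of \<open>a\<close>, +Y/z
    in the conjugated second-order part, and (1 + 2k^2) Y/z is the curvature term. Their
    contributions sum to zero.\<close>
  define Y where "Y = C' r - 2 * c / zz - 2 * B * q - 2 * B^2 * d / zz"
  have Y: "Y = 2 * of_real M * w r q / zz"
  proof -
    have "C' r * zz - 2 * c - 2 * B * q * zz - 2 * B^2 * d = 2 * of_real M * w r q"
      unfolding defs(1-3) C_def D_def z_def w_def defs(4)[symmetric] aB by algebra
    then show ?thesis using nz by (simp add: Y_def field_simps)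
  qed
  have PQ: "c * (C' r / (2 * c) - 2 / zz)^2 + d * (- q / d - 2 * B / zz)^2 = C' r ^2 / (4 * c) + q^2 / d - 2 * Y / zz"
    unfolding Y_def using nz by (simp add: divide_simps) algebra
  \<comment> \<open>The isolated summand kappa stems from C'' = 2 and becomes the constant -k of the
    Teukolsky operator.\<close>
  have L: "c * (l^2 + (\<kappa> / 2 * (2 / c - C' r ^2 / c^2) - 1 / zz^2)) + (C' r - 2 * c / zz) * l
      + d * (m^2 + - (B^2) / zz^2) + (- 2 * q - 2 * B * d / zz) * m
      = \<kappa>^2 * C' r ^2 / (4 * c) + \<kappa> + Y / zz"
    unfolding l m Y_def using nz by (simp add: divide_simps) algebra
  have "of_real k ^2 * (C r * P r q ^2 + D q * Q r q ^2)
      - C r * (l^2 + dr (lam k 2) r q) - (C' r - 2 * C r / z r q) * l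
      - D q * (m^2 + dq (lam k 3) r q) - (- 2 * q - 2 * b * D q / z r q) * m
      + (1 + 2 * of_real k ^2) * (2 * of_real M * w r q / z r q ^2)
    = \<kappa>^2 * (C' r ^2 / (4 * c) + q^2 / d - 2 * Y / zz) - (\<kappa>^2 * C' r ^2 / (4 * c) + \<kappa> + Y / zz)
      + (1 + 2 * \<kappa>^2) * (Y / zz)"
    unfolding PQ[symmetric] L[symmetric] P_def Q_def lr mq defs[symmetric] unfolding Y
    by (simp add: power2_eq_square)
  also have "\<dots> = \<kappa>^2 * q^2 / d - \<kappa>" using nz by (simp add: field_simps)
  finally show ?thesis by (simp add: defs)
qed

lemma Oop_eq_Teuk_coeffs:
  assumes smooth: "smooth_on U Phi" and x: "x \<in> U" and rq: "r = of_real (x$2)" "q = of_real (x$3)"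
  shows "lamp a x / lamm a x * lamp a x / complex_of_real (Delta M a (x$2) powr (k/2))
         * Oop M a k (\<lambda>y. complex_of_real (Delta M a (y$2) powr (k/2)) / lamp a y * Phi y) x =
    ((r^2 + aa^2)^2 / C r - aa^2 * D q) * pd 1 (pd 1 Phi) x + 4 * of_real M * aa * r / C r * pd 1 (pd 4 Phi) x
     + (aa^2 / C r - 1 / D q) * pd 4 (pd 4 Phi) x
     - (C r * pd 2 (pd 2 Phi) x + (of_real k + 1) * C' r * pd 2 Phi x)
     - (D q * pd 3 (pd 3 Phi) x - 2 * q * pd 3 Phi x)
     - 2 * of_real k * (of_real M * (r^2 - aa^2) / C r - r + \<i> * aa * q) * pd 1 Phi x
     - 2 * of_real k * (aa * (r - of_real M) / C r - \<i> * q / D q) * pd 4 Phi x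
     + (of_real k ^2 * q^2 / D q - of_real k) * Phi x"
proof -
  have rg: "reg r q" using U_reg[OF x] by (simp add: rq)
  have nz: "z r q \<noteq> 0" "w r q \<noteq> 0" "C r \<noteq> 0" "D q \<noteq> 0" using rg by (auto simp: reg_def)
  have S: "complex_of_real (Delta M a (x$2) powr (k/2)) \<noteq> 0" using x by (simp add: U_def)
  \<comment> \<open>The outer prefactor is (w/z) / (z C^(k/2)), exactly the reciprocal of z/w times
    the weight pulled out in \<open>Oop_eq\<close>.\<close>
  have pre: "lamp a x / lamm a x * lamp a x / complex_of_real (Delta M a (x$2) powr (k/2)) * (z r q / w r q * wt k x * X) = X" for X
    using nz S by (simp add: lamp_eq lamm_eq wt_def rq)
  have c14: "2 * ((r^2 + aa^2) * aa / C r - aa) = 4 * of_real M * aa * r / C r"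
  proof -
    have "2 * ((r^2 + aa^2) * aa - aa * C r) = 4 * of_real M * aa * r" unfolding C_def by algebra
    then show ?thesis using nz by (simp add: field_simps)
  qed
  \<comment> \<open>The summand 1/z of the weight's logarithmic derivative cancels the conformal
    term -2C/z, and its C^(k/2) part raises C' to (k+1) C'; \<open>c3\<close> is the q
    analogue.\<close>
  have c2: "2 * C r * lam k 2 r q + (C' r - 2 * C r / z r q) = (of_real k + 1) * C' r"
    using nz by (simp add: lam_def field_simps)
  have c3: "2 * D q * lam k 3 r q + (- 2 * q - 2 * b * D q / z r q) = - 2 * q"
    using nz by (simp add: lam_def)
  have ii: "\<i> * \<i> = - 1" by simp
  have c1: "2 * (\<i> * of_real k) * (Q r q * aa * D q - \<i> * P r q * (r^2 + aa^2))
      = 2 * of_real k * (of_real M * (r^2 - aa^2) / C r - r + \<i> * aa * q)"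
    unfolding first_order_coeffs(1)[OF rg, symmetric] using ii by algebra
  have c4: "2 * (\<i> * of_real k) * (Q r q - \<i> * P r q * aa) = 2 * of_real k * (aa * (r - of_real M) / C r - \<i> * q / D q)"
    unfolding first_order_coeffs(2)[OF rg, symmetric] using ii by algebra
  have regroup: "e11 * p11 + e14 * p14 + e44 * p44 - J * (A * p1 + B * p4) + N * p0
      - c * ((l2 + l') * p0 + 2 * l * p2 + p22) - U2 * (l * p0 + p2)
      - d * ((m2 + m') * p0 + 2 * m * p3 + p33) - U3 * (m * p0 + p3) + s * p0
    = e11 * p11 + e14 * p14 + e44 * p44 - (c * p22 + (2 * c * l + U2) * p2) - (d * p33 + (2 * d * m + U3) * p3)
      - J * A * p1 - J * B * p4 + (N - c * (l2 + l') - U2 * l - d * (m2 + m') - U3 * m + s) * p0"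
    for e11 e14 e44 p11 p14 p44 J A B p1 p4 N p0 c l2 l' l p2 p22 U2 d m2 m' m p3 p33 U3 s :: complex
    by algebra
  show ?thesis
    unfolding wt_def[symmetric] Oop_eq[OF smooth x rq] pre
    unfolding regroup c14 c2 c3 c1 c4 zeroth_order_coeff[OF rg] by simp
qed

end

subsection \<open>The Teukolsky operator in the variable \<open>q = cos \<theta>\<close>\<close>

definition cosq :: "pt \<Rightarrow> pt" where
  "cosq y = (\<chi> i. if i = 3 then cos (y$i) else y$i)"

lemma cosq_nth [simp]: "cosq y $ 3 = cos (y$3)" "i \<noteq> 3 \<Longrightarrow> cosq y $ i = y$i"
  by (simp_all add: cosq_def)

lemma pd_cosq: "i \<noteq> 3 \<Longrightarrow> pd i (\<lambda>y. G (cosq y)) y = pd i G (cosq y)"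
proof -
  assume "i \<noteq> 3"
  then have "cosq (y + s *\<^sub>R axis i 1) = cosq y + s *\<^sub>R axis i 1" for s
    by (auto simp: vec_eq_iff cosq_def axis_def)
  then show ?thesis by (simp add: pd_def)
qed

text \<open>A theta-line is mapped into a q-line, so the one-variable chain rule along that line is
  enough.\<close>

lemma has_pd_cosq_3:
  fixes G :: "pt \<Rightarrow> complex"
  assumes "G differentiable (at (cosq y))"
  shows "has_pd 3 (\<lambda>y. G (cosq y)) (- of_real (sin (y$3)) * pd 3 G (cosq y)) y"
proof -
  define u where "u = (\<lambda>s. cos (y$3 + s) - cos (y$3))"
  have u: "(u has_vector_derivative - sin (y$3)) (at 0)"
    unfolding u_def has_real_derivative_iff_has_vector_derivative[symmetric]
    by (auto intro!: derivative_eq_intros)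
  have G: "((\<lambda>t. G (cosq y + t *\<^sub>R axis 3 1)) has_vector_derivative pd 3 G (cosq y)) (at (u 0))"
    using differentiable_imp_has_pd_line[of G "cosq y" 0 3] assms by (simp add: u_def)
  have "cosq (y + s *\<^sub>R axis 3 1) = cosq y + u s *\<^sub>R axis 3 1" for s
    by (auto simp: vec_eq_iff cosq_def axis_def u_def)
  then show ?thesis
    unfolding has_pd_def using vector_diff_chain_at[OF u G] by (simp add: o_def scaleR_conv_of_real)
qed

lemma continuous_cosq: "continuous_on UNIV cosq"
proof -
  have "continuous_on UNIV (\<lambda>y::pt. if i = 3 then cos (y$i) else y$i)" for i
    by (cases "i = 3") (auto intro!: continuous_intros)
  then show ?thesis unfolding cosq_def by (rule continuous_on_vec_lambda)
qed

context kerr begin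

lemma Teuk_eq:
  assumes smooth: "smooth_on U Phi" and x: "x \<in> U" and rq: "r = of_real (x$2)" "q = of_real (x$3)"
    and y: "y = (\<chi> i. if i = 3 then arccos (x$i) else x$i)"
  shows "Teuk M a k (\<lambda>y. Phi (cosq y)) y =
    ((r^2 + aa^2)^2 / C r - aa^2 * D q) * pd 1 (pd 1 Phi) x + 4 * of_real M * aa * r / C r * pd 1 (pd 4 Phi) x
     + (aa^2 / C r - 1 / D q) * pd 4 (pd 4 Phi) x
     - (C r * pd 2 (pd 2 Phi) x + (of_real k + 1) * C' r * pd 2 Phi x)
     - (D q * pd 3 (pd 3 Phi) x - 2 * q * pd 3 Phi x)
     - 2 * of_real k * (of_real M * (r^2 - aa^2) / C r - r + \<i> * aa * q) * pd 1 Phi x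
     - 2 * of_real k * (aa * (r - of_real M) / C r - \<i> * q / D q) * pd 4 Phi x
     + (of_real k ^2 * q^2 / D q - of_real k) * Phi x"
proof -
  have x3: "-1 < x$3" "x$3 < 1" and pos: "Delta M a (x$2) > 0" using x by (auto simp: U_def)
  have yx: "cosq y = x" using x3 by (auto simp: vec_eq_iff cosq_def y)
  have y2: "y$2 = x$2" and cy: "cos (y$3) = x$3" using x3 by (simp_all add: y)
  have sy: "sin (y$3) ^2 = Dfun (x$3)" using sin_squared_eq[of "y$3"] cy by (simp add: Dfun_def)
  have "0 < arccos (x$3)" "arccos (x$3) < pi" using x3 by (simp_all add: arccos_lt_bounded)
  then have s0: "sin (y$3) > 0" by (simp add: y sin_gt_zero)
  have cot: "cot (y$3) ^2 = (x$3)^2 / Dfun (x$3)" by (simp add: cot_def power_divide cy sy)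
  have d: "G differentiable (at v)" if "smooth_on U G" "v \<in> U" for G v
    using smooth_on_imp_differentiable that .
  note sm = smooth_on_pd[OF smooth]
  \<comment> \<open>These hold at every point, differentiable or not, because the t, r and phi lines
    are only translated; the theta derivative needs the neighbourhood \<open>V\<close>
    below.\<close>
  have p1: "pd 1 (\<lambda>y. Phi (cosq y)) = (\<lambda>y. pd 1 Phi (cosq y))" "pd 4 (\<lambda>y. Phi (cosq y)) = (\<lambda>y. pd 4 Phi (cosq y))"
    "pd 2 (\<lambda>y. Phi (cosq y)) = (\<lambda>y. pd 2 Phi (cosq y))" by (simp_all add: fun_eq_iff pd_cosq)
  have D2: "of_real (Delta M a (x$2) powr (-k)) *
      pd 2 (\<lambda>v. complex_of_real (Delta M a (v$2) powr (k + 1)) * pd 2 Phi (cosq v)) y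
      = C r * pd 2 (pd 2 Phi) x + (of_real k + 1) * C' r * pd 2 Phi x"
  proof -
    have "pd 2 (\<lambda>v. complex_of_real (Delta M a (v$2) powr (k + 1)) * pd 2 Phi (cosq v)) y
        = pd 2 (\<lambda>v. complex_of_real (Delta M a (v$2) powr (k + 1)) * pd 2 Phi v) x"
      using pd_cosq[of 2 "\<lambda>v. complex_of_real (Delta M a (v$2) powr (k + 1)) * pd 2 Phi v" y] by (simp add: yx)
    also have "\<dots> = complex_of_real (Delta M a (x$2) powr (k + 1)) * pd 2 (pd 2 Phi) x
        + complex_of_real (Delta M a (x$2) powr (k + 1)) * (of_real (k + 1) * C' r / C r) * pd 2 Phi x"
      unfolding rq
      by (rule has_pd_imp_pd[OF has_pd_mult[OF has_pd_Delta_powr(1)[OF x] differentiable_imp_has_pd[OF d[OF sm x]]]])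
    finally have e: "pd 2 (\<lambda>v. complex_of_real (Delta M a (v$2) powr (k + 1)) * pd 2 Phi (cosq v)) y
        = of_real (Delta M a (x$2) powr (k + 1)) * (pd 2 (pd 2 Phi) x + (of_real k + 1) * C' r / C r * pd 2 Phi x)"
      by (simp add: algebra_simps)
    have "Delta M a (x$2) powr (-k) * Delta M a (x$2) powr (k + 1) = Delta M a (x$2)"
      using pos by (simp flip: powr_add)
    then have "complex_of_real (Delta M a (x$2) powr (-k)) * of_real (Delta M a (x$2) powr (k + 1)) = C r"
      unfolding of_real_mult[symmetric] by (simp add: of_real_Delta rq)
    moreover have "C r \<noteq> 0" using U_reg[OF x] by (simp add: reg_def rq)
    ultimately show ?thesis unfolding e mult.assoc[symmetric] by (simp add: distrib_left)
  qed
  have D3: "of_real (1 / sin (y$3)) * pd 3 (\<lambda>v. complex_of_real (sin (v$3)) * pd 3 (\<lambda>y. Phi (cosq y)) v) y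
      = D q * pd 3 (pd 3 Phi) x - 2 * q * pd 3 Phi x"
  proof -
    \<comment> \<open>The chain rule for \<open>pd 3\<close> is valid only where Phi is known to be
      differentiable, so the inner derivative is rewritten on an open set around y before
      differentiating again.\<close>
    define V where "V = cosq -` U"
    have V: "open V" "y \<in> V" using open_vimage[OF open_U continuous_cosq] x by (auto simp: V_def yx)
    define S where "S = complex_of_real (sin (y$3))"
    have "pd 3 (\<lambda>v. complex_of_real (sin (v$3)) * pd 3 (\<lambda>y. Phi (cosq y)) v) y
        = pd 3 (\<lambda>v. - of_real (sin (v$3) ^2) * pd 3 Phi (cosq v)) y"
    proof (rule pd_cong_open[OF V])
      fix v assume "v \<in> V"
      then have "pd 3 (\<lambda>y. Phi (cosq y)) v = - of_real (sin (v$3)) * pd 3 Phi (cosq v)"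
        by (intro has_pd_imp_pd has_pd_cosq_3 d[OF smooth]) (simp add: V_def)
      then show "complex_of_real (sin (v$3)) * pd 3 (\<lambda>y. Phi (cosq y)) v = - of_real (sin (v$3) ^2) * pd 3 Phi (cosq v)"
        by (simp add: power2_eq_square)
    qed
    \<comment> \<open>Both terms carry another factor sin, which the 1/sin outside cancels: the
      theta operator becomes the q-derivative of D times the q-derivative.\<close>
    also have "\<dots> = - of_real (sin (y$3) ^2) * (- S * pd 3 (pd 3 Phi) x) + (- 2 * S * q) * pd 3 Phi x"
    proof -
      have "((\<lambda>s. - (sin (y$3 + s) ^2)) has_real_derivative - (2 * sin (y$3) * cos (y$3))) (at 0)"
        by (auto intro!: derivative_eq_intros)
      then have "((\<lambda>s. complex_of_real (- (sin (y$3 + s) ^2))) has_vector_derivative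
          of_real (- (2 * sin (y$3) * cos (y$3)))) (at 0)"
        unfolding has_real_derivative_iff_has_vector_derivative
        by (rule bounded_linear.has_vector_derivative[OF bounded_linear_of_real])
      then have A: "has_pd 3 (\<lambda>v. - complex_of_real (sin (v$3) ^2)) (- 2 * S * q) y"
        by (simp add: has_pd_def axis_def S_def cy rq)
      have B: "has_pd 3 (\<lambda>v. pd 3 Phi (cosq v)) (- S * pd 3 (pd 3 Phi) x) y"
        using has_pd_cosq_3[of "pd 3 Phi" y] d[OF sm x] by (simp add: yx S_def)
      show ?thesis using has_pd_imp_pd[OF has_pd_mult[OF A B]] unfolding yx .
    qed
    also have "\<dots> = S * (D q * pd 3 (pd 3 Phi) x - 2 * q * pd 3 Phi x)"
      unfolding sy of_real_Dfun rq[symmetric] by (simp add: algebra_simps)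
    finally show ?thesis using s0 by (simp add: S_def)
  qed
  show ?thesis
    unfolding Teuk_def Let_def p1 y2 D2 D3 unfolding pd_cosq[OF four_distinct(2)] pd_cosq[OF four_distinct(12)] yx cy sy cot
    by (simp add: of_real_Delta of_real_Dfun rq)
qed

end

theorem theoremA:
  fixes M a k :: real and Phi :: "real^4 \<Rightarrow> complex" and x :: "real^4"
  assumes k_half_int: "\<exists>n::int. k = real_of_int n / 2"
    and smooth: "smooth_on {y. Delta M a (y$2) > 0 \<and> -1 < y$3 \<and> y$3 < 1 \<and> rho2 a (y$2) (y$3) \<noteq> 0} Phi"
    and x_in: "x \<in> {y. Delta M a (y$2) > 0 \<and> -1 < y$3 \<and> y$3 < 1 \<and> rho2 a (y$2) (y$3) \<noteq> 0}"
  shows "Teuk M a k (\<lambda>y. Phi (\<chi> i. if i = 3 then cos (y$i) else y$i))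
                    (\<chi> i. if i = 3 then arccos (x$i) else x$i)
       = lamp a x / lamm a x * lamp a x / complex_of_real (Delta M a (x$2) powr (k/2))
         * Oop M a k (\<lambda>y. complex_of_real (Delta M a (y$2) powr (k/2)) / lamp a y * Phi y) x"
proof -
  interpret kerr M a .
  have smooth': "smooth_on U Phi" and x: "x \<in> U" using smooth x_in by (simp_all add: U_def)
  show ?thesis
    using Teuk_eq[OF smooth' x refl refl refl, of k] Oop_eq_Teuk_coeffs[OF smooth' x refl refl, of k]
    by (simp add: cosq_def)
qed

end
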